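(* Let $T\subset\mathbb{C}$ be a connected compact set that is neither empty nor a single point, let $r_T$ be its conformal radius, and let $\tau_0=\frac12e^{2\gamma}r_T^2$, where $\gamma$ is the Euler–Mascheroni constant. For each fixed $z$ in the exterior of $T$, $$\left|P_T(z,t)-\left(1-\frac{2\pi H_T(z)}{\ln(t/\tau_0)}\right)\right|\ \le\ \frac{\ln\left(\ln^2(t/\tau_0)\right)}{\ln^2(t/\tau_0)}\left[2\pi H_T(z)+o(1)\right]\qquad\text{as } t\to\infty .$$
   Context: The plane is identified with $\mathbb{C}$; the exterior of $T$ is the unbounded component of $\mathbb{C}\setminus T$. $P_T(z,t)$ denotes the probability that a standard planar Brownian motion (transition density $\frac{1}{2\pi t}e^{-|z-w|^2/(2t)}$) started at $z$ hits $T$ by time $t$. Here $\ln^2 x$ means $(\ln x)^2$. The $o(1)$ term is a function of $t$ (which may depend on $T$ and $z$) tending to $0$ as $t\to\infty$; the inequality is asserted for all sufficiently large $t$. Conformal radius: let $\Phi_T$ be the unique conformal map from the exterior of $T$ (with $\infty$ adjoined) onto the complement of the closed unit disk in the Riemann sphere which fixes $\infty$ and has positive derivative at $\infty$ (i.e. $\lim_{z\to\infty}\Phi_T(z)/z>0$). Then $r_T:=\lim_{z\to\infty} z/\Phi_T(z)$. $H_T$ is the Green's function with pole at $\infty$: the unique harmonic function on the exterior of $T$ that tends to $0$ as $z\to T$ and satisfies $H_T(z)\sim\frac1\pi\ln|z|$ as $z\to\infty$; equivalently $H_T(z)=\frac1\pi\ln|\Phi_T(z)|$. *)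

theory Defs
  imports "HOL-Probability.Probability" "HOL-Library.Landau_Symbols"
begin

text \<open>
  For compact \<open>T\<close> in the plane, the library's \<^const>\<open>outside\<close> is the exterior: the points whose
  component in the complement of \<open>T\<close> is unbounded, and there is exactly one such component.
\<close>

definition planar_heat_kernel :: "real \<Rightarrow> complex \<Rightarrow> complex \<Rightarrow> real" where
  "planar_heat_kernel t z w = exp (- (norm (z - w))\<^sup>2 / (2 * t)) / (2 * pi * t)"

text \<open>
  Paths are continuous surely, not just almost surely. For closed \<open>T\<close> this makes the hitting
  event below measurable, so that \<^const>\<open>measure\<close> does not silently return \<open>0\<close>. An increasing
  sequence of times may be eventually constant; its constant increments are then trivially
  independent of the others, so this covers all finite families of increments.
\<close>

definition planar_brownian_motion ::
    "'a measure \<Rightarrow> (real \<Rightarrow> 'a \<Rightarrow> complex) \<Rightarrow> complex \<Rightarrow> bool" where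
  "planar_brownian_motion M B z \<longleftrightarrow>
     prob_space M \<and>
     (\<forall>t\<ge>0. B t \<in> borel_measurable M) \<and>
     (\<forall>\<omega>\<in>space M. B 0 \<omega> = z) \<and>
     (\<forall>\<omega>\<in>space M. continuous_on {0..} (\<lambda>t. B t \<omega>)) \<and>
     (\<forall>s t. 0 \<le> s \<and> s < t \<longrightarrow>
        distributed M lborel (\<lambda>\<omega>. B t \<omega> - B s \<omega>)
          (\<lambda>w. ennreal (planar_heat_kernel (t - s) 0 w))) \<and>
     (\<forall>\<sigma> :: nat \<Rightarrow> real. 0 \<le> \<sigma> 0 \<and> incseq \<sigma> \<longrightarrow>
        prob_space.indep_vars M (\<lambda>_. borel)
          (\<lambda>i \<omega>. B (\<sigma> (Suc i)) \<omega> - B (\<sigma> i) \<omega>) UNIV)"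

definition hitting_prob ::
    "'a measure \<Rightarrow> (real \<Rightarrow> 'a \<Rightarrow> complex) \<Rightarrow> complex set \<Rightarrow> real \<Rightarrow> real" where
  "hitting_prob M B T t = measure M {\<omega> \<in> space M. \<exists>s\<in>{0..t}. B s \<omega> \<in> T}"

text \<open>
  A finite positive limit of \<open>\<Phi> z / z\<close> says that the extension by \<open>\<Phi> \<infinity> = \<infinity>\<close> is holomorphic at
  \<open>\<infinity>\<close> with positive derivative, so the Riemann sphere need not be mentioned. The values outside
  the exterior carry no meaning; they are set to \<open>0\<close> only to make the total function unique.
\<close>

definition exterior_map :: "complex set \<Rightarrow> complex \<Rightarrow> complex" where
  "exterior_map T = (THE \<Phi>.
     \<Phi> holomorphic_on outside T \<and>
     bij_betw \<Phi> (outside T) {w. norm w > 1} \<and>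
     (\<exists>c>0. ((\<lambda>z. \<Phi> z / z) \<longlongrightarrow> complex_of_real c) at_infinity) \<and>
     (\<forall>z. z \<notin> outside T \<longrightarrow> \<Phi> z = 0))"

definition conformal_radius :: "complex set \<Rightarrow> real" where
  "conformal_radius T =
     (THE r. ((\<lambda>z. z / exterior_map T z) \<longlongrightarrow> complex_of_real r) at_infinity)"

text \<open>\<open>C\<^sup>2\<close> with vanishing Laplacian.\<close>

definition harmonic_on :: "(complex \<Rightarrow> real) \<Rightarrow> complex set \<Rightarrow> bool" where
  "harmonic_on u S \<longleftrightarrow> open S \<and>
     (\<exists>ux uy uxx uxy uyx uyy.
        continuous_on S uxx \<and> continuous_on S uxy \<and>
        continuous_on S uyx \<and> continuous_on S uyy \<and>
        (\<forall>z\<in>S.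
           (u has_derivative (\<lambda>h. ux z * Re h + uy z * Im h)) (at z) \<and>
           (ux has_derivative (\<lambda>h. uxx z * Re h + uxy z * Im h)) (at z) \<and>
           (uy has_derivative (\<lambda>h. uyx z * Re h + uyy z * Im h)) (at z) \<and>
           uxx z + uyy z = 0))"

text \<open>As for \<^const>\<open>exterior_map\<close>, the values outside the exterior are a mere convention.\<close>

definition green_infinity :: "complex set \<Rightarrow> complex \<Rightarrow> real" where
  "green_infinity T = (THE H.
     harmonic_on H (outside T) \<and>
     (\<forall>\<zeta>\<in>T. (H \<longlongrightarrow> 0) (at \<zeta> within outside T)) \<and>
     H \<sim>[at_infinity] (\<lambda>z. 1 / pi * ln (norm z)) \<and>
     (\<forall>z. z \<notin> outside T \<longrightarrow> H z = 0))"

end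

theory Submission
  imports Defs "HOL-Complex_Analysis.Complex_Analysis" "HOL-Real_Asymp.Real_Asymp"
begin

text \<open>
  Let \<open>H\<close> be the Green function, extended by \<open>0\<close>, and let \<open>S\<close> be the event that the path avoids \<open>T\<close>
  up to time \<open>t\<close>. Since \<open>H\<close> is harmonic off \<open>T\<close> and vanishes on \<open>T\<close>, the expectation of \<open>H (B t)\<close> on \<open>S\<close>
  equals \<open>H z\<close>. Both inequalities are obtained by sampling the path at the times \<open>j t / n\<close>: a centred
  planar Gaussian is rotation invariant, so by the mean value property one step preserves \<open>H\<close> up to
  the exponentially small mass of the jumps that leave a disc in the exterior.

  As \<open>pi * H w = ln (norm w) + O(1)\<close> at infinity, \<open>pi * H (B t)\<close> is essentially at most \<open>ln R\<close> for
  \<open>R = sqrt (t * ln t)\<close>, which bounds the probability of \<open>S\<close> from below; it is at least \<open>ln R - O(1)\<close> for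
  \<open>R = sqrt t / ln t\<close> unless \<open>norm (B t) < R\<close>, an event of probability \<open>O(1 / ln\<^sup>2 t)\<close>, which gives the
  upper bound. The factor \<open>ln t\<close> in the second choice of \<open>R\<close> is exactly what the error term
  \<open>ln (ln\<^sup>2 t) / ln\<^sup>2 t\<close> allows; it also absorbs the value of \<open>\<tau>\<^sub>0 > 0\<close>.
\<close>

text \<open>A walk sampled at grid times can jump over \<open>T\<close> unseen. The level sets
  \<open>{w. H w \<ge> \<eta>}\<close> repair this: each has a positive distance \<open>r\<close>
  from the zero set of \<open>H\<close>, so one step leaves a disc of radius \<open>r\<close> with
  probability exponentially small in \<open>n\<close>, and \<open>n\<close> such errors still vanish
  in the limit. Walks that drop below \<open>\<eta>\<close> are killed, and \<open>H\<close> is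
  truncated so that each inequality survives the killing: capping \<open>H\<close> at
  \<open>m\<close> bounds what the rare long jumps can add, and \<open>max (H w - \<eta>) 0\<close>
  is already zero where a walk is killed. The level \<open>\<eta>\<close> goes to 0 only after the
  mesh does. Independence and the Gaussian law of the increments thus suffice, and no stopping times
  occur. Since \<open>exterior_map\<close> and \<open>green_infinity\<close> are definite
  descriptions, existence and uniqueness come first. Existence is the Riemann mapping theorem for
  the exterior inverted in a point of \<open>T\<close>; uniqueness of the map is reduced to that of
  the Green function, because the modulus of the map leaves only a rotation free.\<close>

section \<open>The conformal map of the exterior\<close>

text \<open>The exterior with infinity adjoined, in the coordinate \<open>1 / (z - a)\<close>, where
  0 stands for infinity. For \<open>a \<in> T\<close> this is a planar domain to which the Riemann
  mapping theorem can be applied.\<close>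

definition inverted_exterior :: "complex set \<Rightarrow> complex \<Rightarrow> complex set" where
  "inverted_exterior T a = insert 0 {w. w \<noteq> 0 \<and> a + 1 / w \<in> outside T}"

lemma compact_outside_cofinite:
  fixes T :: "complex set"
  assumes "compact T"
  obtains R where "R > 0" "\<And>z. norm z \<ge> R \<Longrightarrow> z \<in> outside T"
proof -
  have "bounded (- outside T)"
    using assms cobounded_outside compact_imp_bounded by blast
  then obtain R where "R > 0" "- outside T \<subseteq> ball 0 R"
    using bounded_subset_ballD by blast
  then show ?thesis by (intro that[of R]) fastforce+
qed

lemma open_outside_compact: "compact (T :: complex set) \<Longrightarrow> open (outside T)"
  by (simp add: open_outside compact_imp_closed)

lemma inverted_exterior_ball:
  assumes "compact T"
  obtains e where "e > 0" "ball 0 e \<subseteq> inverted_exterior T a"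
proof -
  obtain R where R: "R > 0" "\<And>z. norm z \<ge> R \<Longrightarrow> z \<in> outside T"
    by (rule compact_outside_cofinite[OF assms]) (rule that; assumption)
  let ?e = "1 / (R + norm a)"
  have "w \<in> inverted_exterior T a" if "w \<in> ball 0 ?e" for w
  proof (cases "w = 0")
    case False
    have "norm w * (R + norm a) < 1"
      using that R(1) by (simp add: field_simps add_pos_nonneg)
    then have "norm (1 / w) > R + norm a"
      using False by (simp add: norm_divide field_simps)
    moreover have "norm (1 / w) \<le> norm (a + 1 / w) + norm a"
      by (metis add_diff_cancel_left' norm_triangle_ineq4)
    ultimately show ?thesis
      using R(2)[of "a + 1 / w"] False by (simp add: inverted_exterior_def)
  qed (simp add: inverted_exterior_def)
  then show ?thesis
    using R(1) by (intro that[of ?e]) (auto simp: add_pos_nonneg)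
qed

lemma open_inverted_exterior:
  assumes "compact T"
  shows "open (inverted_exterior T a)"
proof -
  obtain e where e: "e > 0" "ball 0 e \<subseteq> inverted_exterior T a"
    using inverted_exterior_ball[OF assms] .
  have "continuous_on (- {0}) (\<lambda>w::complex. a + 1 / w)"
    by (intro continuous_intros) auto
  then have "open ((\<lambda>w. a + 1 / w) -` outside T \<inter> - {0})"
    using continuous_open_preimage[of "- {0}" "\<lambda>w. a + 1 / w" "outside T"]
      open_outside_compact[OF assms] by (simp add: Int_commute open_Compl)
  moreover have "inverted_exterior T a = ball 0 e \<union> ((\<lambda>w. a + 1 / w) -` outside T \<inter> - {0})"
    using e by (auto simp: inverted_exterior_def)
  ultimately show ?thesis by (metis open_Un open_ball)
qed

lemma inverted_exterior_eq:
  assumes "a \<in> T"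
  shows "inverted_exterior T a = insert 0 ((\<lambda>z. 1 / (z - a)) ` outside T)"
proof -
  have "w \<in> (\<lambda>z. 1 / (z - a)) ` outside T" if "w \<noteq> 0" "a + 1 / w \<in> outside T" for w
    by (rule image_eqI[OF _ that(2)]) simp
  moreover have "z \<noteq> a" if "z \<in> outside T" for z
    using that assms outside_no_overlap by blast
  ultimately show ?thesis
    by (auto simp: inverted_exterior_def)
qed

text \<open>Inversion carries the connected exterior to a connected set with 0 in its closure, since
  every point near 0 other than 0 itself comes from a point near infinity. Adding a point of the
  closure keeps a set connected.\<close>

lemma connected_inverted_exterior:
  assumes "compact T" "a \<in> T"
  shows "connected (inverted_exterior T a)"
proof -
  let ?f = "\<lambda>z. 1 / (z - a)"
  have "connected (outside T)"
    using assms by (intro connected_outside compact_imp_bounded) auto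
  moreover have "z \<noteq> a" if "z \<in> outside T" for z
    using that assms(2) outside_no_overlap[of T] by blast
  then have "continuous_on (outside T) ?f"
    by (intro continuous_intros) auto
  ultimately have con: "connected (?f ` outside T)"
    using connected_continuous_image by blast
  obtain e where e: "e > 0" "ball 0 e \<subseteq> inverted_exterior T a"
    using inverted_exterior_ball[OF assms(1)] .
  have "0 \<in> closure (?f ` outside T)"
    unfolding closure_approachable
  proof (intro allI impI)
    fix d :: real assume "d > 0"
    let ?y = "complex_of_real (min d e / 2)"
    have "?y \<in> inverted_exterior T a" "?y \<noteq> 0"
      using e \<open>d > 0\<close> by (auto intro!: subsetD[OF e(2)] simp del: of_real_divide of_real_numeral)
    then have "?y \<in> ?f ` outside T"
      using inverted_exterior_eq[OF assms(2)] by blast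
    moreover have "dist ?y 0 < d"
      using e \<open>d > 0\<close> by (simp del: of_real_divide of_real_numeral)
    ultimately show "\<exists>y\<in>?f ` outside T. dist y 0 < d" by blast
  qed
  then show ?thesis
    unfolding inverted_exterior_eq[OF assms(2)]
    by (intro connected_intermediate_closure[OF con]) (use closure_subset[of "?f ` outside T"] in blast)+
qed

text \<open>The criterion is that closed paths wind zero times around points \<open>w\<close> off
  the domain. Here connectedness of \<open>T\<close> enters: the complement of the exterior is
  \<open>T\<close> with its holes filled, a connected set. Pulling back the inside and the outside
  of the path by the inversion splits this set into two relatively open pieces. The piece of the
  outside contains \<open>a\<close>, so the other one is empty and \<open>w\<close> lies outside the
  path.\<close>

lemma simply_connected_inverted_exterior:
  assumes "compact T" "connected T" "a \<in> T"
  shows "simply_connected (inverted_exterior T a)"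
proof -
  let ?W = "inverted_exterior T a" and ?f = "\<lambda>z. 1 / (z - a)"
  have a: "a \<notin> outside T" using assms outside_no_overlap by blast
  have "winding_number g w = 0"
    if g: "path g" "path_image g \<subseteq> ?W" "pathfinish g = pathstart g" and w: "w \<notin> ?W" for g w
  proof -
    let ?P = "path_image g" and ?K = "T \<union> inside T"
    have comP: "compact ?P" using g by (simp add: compact_path_image)
    have "connected ?K"
      using assms by (intro connected_with_inside) (auto simp: compact_imp_closed)
    moreover have K: "?K = - outside T"
      using inside_Un_outside[of T] inside_Int_outside[of T] outside_no_overlap[of T] by blast
    ultimately have conK: "connected (- outside T)" by simp
    obtain B where B: "B > 0" "\<And>v. norm v \<ge> B \<Longrightarrow> v \<in> outside ?P"
      by (rule compact_outside_cofinite[OF comP]) (rule that; assumption)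
    have op: "open (?f -` V \<inter> - {a})" if "open V" for V
    proof -
      have "continuous_on (- {a}) ?f" by (intro continuous_intros) auto
      then show ?thesis
        using continuous_open_preimage[of "- {a}" ?f V] that by (simp add: Int_commute open_Compl)
    qed
    \<comment> \<open>The inversion should send \<open>a\<close> to infinity, but division by zero
      gives it the value 0. Hence \<open>a\<close> is removed from both preimages, and a disc about
      it, whose other points go to the outside of the path, is added to \<open>U\<close>.\<close>
    define U where "U = ball a (1 / B) \<union> (?f -` outside ?P \<inter> - {a})"
    define V where "V = ?f -` inside ?P \<inter> - {a}"
    have "open U" "open V"
      unfolding U_def V_def using comP
      by (auto intro!: op open_Un open_outside_compact open_inside compact_imp_closed)
    have nP: "?f z \<notin> ?P" if "z \<notin> outside T" "z \<noteq> a" for z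
      using g(2) that by (auto simp: inverted_exterior_def subset_iff)
    have ball: "?f z \<in> outside ?P" if "z \<in> ball a (1 / B)" "z \<noteq> a" for z
      using that B(1) by (intro B(2))
        (simp add: norm_divide dist_norm field_simps norm_minus_commute)
    have io: "v \<in> inside ?P \<or> v \<in> outside ?P" if "v \<notin> ?P" for v
      using that inside_Un_outside[of ?P] by blast
    have "x \<in> U \<union> V" if "x \<notin> outside T" for x
      using io[OF nP[OF that]] B(1) unfolding U_def V_def by (cases "x = a") auto
    then have "- outside T \<subseteq> U \<union> V" by blast
    moreover have "U \<inter> V \<inter> - outside T = {}"
      using ball inside_Int_outside[of ?P] unfolding U_def V_def by blast
    moreover have "a \<in> U \<inter> - outside T" using a B(1) by (auto simp: U_def)
    ultimately have V0: "V \<inter> - outside T = {}"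
      using conK \<open>open U\<close> \<open>open V\<close> unfolding connected_def by blast
    have w0: "w \<noteq> 0" "a + 1 / w \<notin> outside T"
      using w by (auto simp: inverted_exterior_def)
    have "a + 1 / w \<in> V" if "w \<in> inside ?P"
      using that w0(1) by (simp add: V_def)
    then have "w \<notin> inside ?P" using V0 w0(2) by blast
    then have "w \<in> outside ?P"
      using w g(2) inside_Un_outside[of ?P] by blast
    then show ?thesis
      using winding_number_zero_in_outside g by blast
  qed
  then show ?thesis
    unfolding simply_connected_eq_winding_number_zero[OF open_inverted_exterior[OF assms(1)]]
    using connected_inverted_exterior[OF assms(1,3)] by blast
qed

text \<open>A disc automorphism moves the image of \<open>p\<close> to 0. With \<open>p = 0\<close>
  in the inverted coordinate, this makes the exterior map fix infinity.\<close>

lemma pointed_Riemann_map: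
  assumes "open S" "simply_connected S" "S \<noteq> UNIV" "p \<in> S"
  obtains f where "f holomorphic_on S" "bij_betw f S (ball 0 1)" "f p = 0"
proof -
  obtain f g where fg: "f holomorphic_on S" "\<forall>z \<in> S. f z \<in> ball 0 1 \<and> g (f z) = z"
                 "\<forall>z \<in> ball 0 1. g z \<in> S \<and> f (g z) = z"
    using simply_connected_eq_biholomorphic_to_disc[OF assms(1)] assms by blast
  have "f p \<in> ball 0 1" using fg assms(4) by blast
  obtain h k where hk: "h (f p) = 0" "h holomorphic_on ball 0 1"
      "h ` ball 0 1 \<subseteq> ball 0 1" "k holomorphic_on ball 0 1" "k ` ball 0 1 \<subseteq> ball 0 1"
      "\<And>z. z \<in> ball 0 1 \<Longrightarrow> h (k z) = z" "\<And>z. z \<in> ball 0 1 \<Longrightarrow> k (h z) = z"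
    by (rule ball_biholomorphism_exists[OF \<open>f p \<in> ball 0 1\<close>]) (rule that; assumption)
  have "bij_betw f S (ball 0 1)"
    by (rule bij_betw_byWitness[where f' = g]) (use fg in auto)
  moreover have "bij_betw h (ball 0 1) (ball 0 1)"
    by (rule bij_betw_byWitness[where f' = k]) (use hk in auto)
  ultimately have "bij_betw (h \<circ> f) S (ball 0 1)" by (rule bij_betw_trans)
  moreover have "(h \<circ> f) holomorphic_on S"
    by (rule holomorphic_on_compose_gen[OF fg(1) hk(2)]) (use fg in blast)
  ultimately show ?thesis using hk(1) that[of "h \<circ> f"] by simp
qed

text \<open>The description in \<open>exterior_map\<close> with the derivative at infinity
  \<open>c\<close> made a parameter, because the conformal radius is \<open>1 / c\<close>.\<close>

definition is_exterior_map :: "complex set \<Rightarrow> (complex \<Rightarrow> complex) \<Rightarrow> real \<Rightarrow> bool" where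
  "is_exterior_map T \<Phi> c \<longleftrightarrow>
     \<Phi> holomorphic_on outside T \<and>
     bij_betw \<Phi> (outside T) {w. norm w > 1} \<and>
     c > 0 \<and> ((\<lambda>z. \<Phi> z / z) \<longlongrightarrow> complex_of_real c) at_infinity \<and>
     (\<forall>z. z \<notin> outside T \<longrightarrow> \<Phi> z = 0)"

lemma eventually_in_outside:
  fixes T :: "complex set"
  assumes "compact T"
  shows "eventually (\<lambda>z. z \<in> outside T) at_infinity"
  by (rule compact_outside_cofinite[OF assms]) (auto simp: eventually_at_infinity)

text \<open>If \<open>f\<close> is the Riemann map of the inverted exterior with
  \<open>f 0 = 0\<close>, then \<open>1 / (u * f (1 / (z - a)))\<close> is the exterior map for a
  suitable \<open>u\<close> of modulus one. The second point \<open>b\<close> shows that the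
  inverted exterior is not the whole plane.\<close>

lemma exterior_map_exists:
  assumes "compact T" "connected T" "a \<in> T" "b \<in> T" "a \<noteq> b"
  shows "\<exists>\<Phi> c. is_exterior_map T \<Phi> c"
proof -
  let ?W = "inverted_exterior T a"
  have ba: "b \<notin> outside T" "a \<notin> outside T"
    using assms outside_no_overlap[of T] by blast+
  have "1 / (b - a) \<notin> ?W"
    using ba assms by (simp add: inverted_exterior_def)
  then have "?W \<noteq> UNIV" by blast
  moreover have "0 \<in> ?W" by (simp add: inverted_exterior_def)
  ultimately obtain f where f: "f holomorphic_on ?W" "bij_betw f ?W (ball 0 1)" "f 0 = 0"
    using pointed_Riemann_map[OF open_inverted_exterior[OF assms(1)]
        simply_connected_inverted_exterior[OF assms(1-3)]] by metis
  have inj: "inj_on f ?W" using f(2) by (simp add: bij_betw_def)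
  have opW: "open ?W" by (rule open_inverted_exterior[OF assms(1)])
  define d where "d = deriv f 0"
  have d: "d \<noteq> 0"
    unfolding d_def by (rule holomorphic_injective_imp_regular[OF f(1) opW inj \<open>0 \<in> ?W\<close>])
  \<comment> \<open>The rotation that turns the derivative \<open>d\<close> into the positive number
    \<open>norm d\<close>.\<close>
  define u where "u = cnj d / norm d"
  have u: "norm u = 1" "u * d = norm d" "u \<noteq> 0"
    using d by (auto simp: u_def norm_divide complex_norm_square[symmetric] mult.commute power2_eq_square)
  let ?g = "\<lambda>z. 1 / (z - a)"
  define \<Phi> where "\<Phi> z = (if z \<in> outside T then 1 / (u * f (?g z)) else 0)" for z
  have za: "z - a \<noteq> 0" if "z \<in> outside T" for z using that ba by auto
  have gW: "?g z \<in> ?W - {0}" if "z \<in> outside T" for z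
    using that za[OF that] by (simp add: inverted_exterior_def)
  have bij1: "bij_betw ?g (outside T) (?W - {0})"
    by (rule bij_betw_byWitness[where f' = "\<lambda>w. a + 1 / w"])
      (use gW za in \<open>auto simp: inverted_exterior_def\<close>)
  have bij2: "bij_betw f (?W - {0}) (ball 0 1 - {0})"
    using bij_betw_DiffI[OF f(2), of "{0}" "{0}"] f(3) \<open>0 \<in> ?W\<close> by (simp add: bij_betw_def)
  have bij3: "bij_betw (\<lambda>w. 1 / (u * w)) (ball 0 1 - {0}) {w. norm w > 1}"
    by (rule bij_betw_byWitness[where f' = "\<lambda>w. 1 / (u * w)"])
      (use u in \<open>auto simp: norm_divide norm_mult divide_less_eq_1 less_divide_eq_1\<close>)
  have "bij_betw ((\<lambda>w. 1 / (u * w)) \<circ> (f \<circ> ?g)) (outside T) {w. norm w > 1}"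
    by (intro bij_betw_trans[OF _ bij3] bij_betw_trans[OF bij1 bij2])
  then have bij: "bij_betw \<Phi> (outside T) {w. norm w > 1}"
    by (rule bij_betw_cong[THEN iffD1, rotated]) (simp add: \<Phi>_def)
  have fnz: "f (?g z) \<noteq> 0" if "z \<in> outside T" for z
    using bij_betwE[OF bij2] gW[OF that] by blast
  have "(f \<circ> ?g) holomorphic_on outside T"
  proof (rule holomorphic_on_compose_gen[OF _ f(1)])
    show "?g holomorphic_on outside T"
      using za by (intro holomorphic_intros) auto
  qed (use gW in blast)
  then have "(\<lambda>z. 1 / (u * f (?g z))) holomorphic_on outside T"
    using fnz u by (intro holomorphic_intros) (auto simp: o_def)
  then have hol: "\<Phi> holomorphic_on outside T"
    by (rule holomorphic_transform) (simp add: \<Phi>_def)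
  have "(f has_field_derivative d) (at 0)"
    unfolding d_def using f(1) opW \<open>0 \<in> ?W\<close> by (rule holomorphic_derivI)
  then have lim: "((\<lambda>w. f w / w) \<longlongrightarrow> d) (at 0)"
    using f(3) by (simp add: has_field_derivative_iff)
  have minf: "filterlim (\<lambda>z. z - a) at_infinity at_infinity"
    using tendsto_add_filterlim_at_infinity'[OF filterlim_ident tendsto_const[of "-a"]] by simp
  then have ginf: "filterlim ?g (at 0) at_infinity"
    by (simp add: divide_inverse filterlim_inverse_at_iff)
  have l1: "((\<lambda>z. f (?g z) / ?g z) \<longlongrightarrow> d) at_infinity"
    using filterlim_compose[OF lim ginf] .
  have l2: "((\<lambda>z. 1 - a * inverse z) \<longlongrightarrow> 1 - a * 0) at_infinity"
    by (intro tendsto_intros tendsto_inverse_0)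
  \<comment> \<open>With \<open>w = 1 / (z - a)\<close>, the quotient \<open>\<Phi> z / z\<close>
    equals \<open>(1 - a / z) / (u * (f w / w))\<close>.\<close>
  have "((\<lambda>z. (1 - a * inverse z) / (u * (f (?g z) / ?g z))) \<longlongrightarrow> (1 - a * 0) / (u * d)) at_infinity"
    using u d by (intro tendsto_intros l1 l2) auto
  also have "(1 - a * 0) / (u * d) = complex_of_real (1 / norm d)"
    using u by simp
  also have "((\<lambda>z. (1 - a * inverse z) / (u * (f (?g z) / ?g z))) \<longlongrightarrow> complex_of_real (1 / norm d)) at_infinity
     \<longleftrightarrow> ((\<lambda>z. \<Phi> z / z) \<longlongrightarrow> complex_of_real (1 / norm d)) at_infinity"
  proof (rule tendsto_cong)
    show "\<forall>\<^sub>F z in at_infinity. (1 - a * inverse z) / (u * (f (?g z) / ?g z)) = \<Phi> z / z"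
      using eventually_in_outside[OF assms(1)] eventually_not_equal_at_infinity[of 0]
    proof eventually_elim
      case (elim z)
      then show ?case using za[of z] u fnz[of z] by (simp add: \<Phi>_def field_simps)
    qed
  qed
  finally have "((\<lambda>z. \<Phi> z / z) \<longlongrightarrow> complex_of_real (1 / norm d)) at_infinity" .
  then have "is_exterior_map T \<Phi> (1 / norm d)"
    unfolding is_exterior_map_def using hol bij d by (simp add: \<Phi>_def)
  then show ?thesis by blast
qed

context
  fixes T \<Phi> c
  assumes ext: "is_exterior_map T \<Phi> c" and comT: "compact T"
begin

lemma exterior_map_holomorphic: "\<Phi> holomorphic_on outside T"
  and exterior_map_bij: "bij_betw \<Phi> (outside T) {w. norm w > 1}"
  and exterior_map_pos: "c > 0"
  and exterior_map_lim: "((\<lambda>z. \<Phi> z / z) \<longlongrightarrow> complex_of_real c) at_infinity"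
  using ext by (auto simp: is_exterior_map_def)

lemma exterior_map_norm_gt_1: "z \<in> outside T \<Longrightarrow> norm (\<Phi> z) > 1"
  using exterior_map_bij by (auto simp: bij_betw_def)

lemma exterior_map_inj:
  "\<Phi> v = \<Phi> w \<Longrightarrow> v \<in> outside T \<Longrightarrow> w \<in> outside T \<Longrightarrow> v = w"
  using exterior_map_bij by (meson bij_betw_def inj_onD)

text \<open>In the coordinate \<open>1 / w\<close> at infinity, \<open>\<Phi>\<close> becomes an
  injective holomorphic \<open>f\<close> near 0, hence an open map. So the points beyond norm
  \<open>R\<close> already cover all values of large modulus, and by injectivity no point of norm at
  most \<open>R\<close> can take such a value.\<close>

lemma exterior_map_bounded:
  "\<exists>S. \<forall>z\<in>outside T. norm z \<le> R \<longrightarrow> norm (\<Phi> z) \<le> S"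
proof -
  obtain R1 where R1: "R1 > 0" "\<And>z. norm z \<ge> R1 \<Longrightarrow> z \<in> outside T"
    by (rule compact_outside_cofinite[OF comT]) (rule that; assumption)
  define e where "e = 1 / max R1 (\<bar>R\<bar> + 1)"
  have e: "e > 0" "1 / e \<ge> R1" "1 / e > R" using R1 by (auto simp: e_def)
  have out: "1 / w \<in> outside T" if "w \<in> ball 0 e - {0}" for w
  proof -
    have "norm (1 / w) \<ge> 1 / e"
      using that e(1) by (auto simp: norm_divide field_simps)
    then show ?thesis using e(2) by (intro R1(2)) simp
  qed
  define f where "f w = (if w = 0 then 0 else 1 / \<Phi> (1 / w))" for w
  have nz: "\<Phi> (1 / w) \<noteq> 0" if "w \<in> ball 0 e - {0}" for w
    using exterior_map_norm_gt_1[OF out[OF that]] by auto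
  have "inj_on f (ball 0 e)"
  proof (rule inj_onI)
    fix v w assume vw: "v \<in> ball 0 e" "w \<in> ball 0 e" "f v = f w"
    show "v = w"
    proof (cases "v = 0 \<or> w = 0")
      case True
      then show ?thesis using vw nz[of v] nz[of w] by (auto simp: f_def split: if_splits)
    next
      case False
      then have "\<Phi> (1 / v) = \<Phi> (1 / w)"
        using vw nz[of v] nz[of w] by (simp add: f_def)
      then have "1 / v = 1 / w"
        by (rule exterior_map_inj) (use out vw False in auto)
      then show ?thesis by simp
    qed
  qed
  \<comment> \<open>The limit of \<open>\<Phi> z / z\<close> forces \<open>f w\<close> to tend to 0,
    so the singularity at 0 is removable.\<close>
  moreover have "f holomorphic_on ball 0 e"
  proof (rule no_isolated_singularity'[of "{0}"])
    have "(\<Phi> \<circ> (\<lambda>w. 1 / w)) holomorphic_on ball 0 e - {0}"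
      by (rule holomorphic_on_compose_gen[OF _ exterior_map_holomorphic])
        (use out in \<open>force intro!: holomorphic_intros\<close>)+
    then have "(\<lambda>w. 1 / \<Phi> (1 / w)) holomorphic_on ball 0 e - {0}"
      using nz by (intro holomorphic_intros) (auto simp: o_def)
    then show "f holomorphic_on ball 0 e - {0}"
      by (rule holomorphic_transform) (simp add: f_def)
    have "((\<lambda>w. \<Phi> (inverse w) / inverse w) \<longlongrightarrow> complex_of_real c) (at 0)"
      by (rule filterlim_compose[OF exterior_map_lim filterlim_inverse_at_infinity])
    then have "((\<lambda>w. w / (\<Phi> (inverse w) / inverse w)) \<longlongrightarrow> 0 / complex_of_real c) (at 0)"
      using exterior_map_pos by (intro tendsto_intros) auto
    moreover have "\<forall>\<^sub>F w in at 0. w / (\<Phi> (inverse w) / inverse w) = f w"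
    proof -
      have "\<forall>\<^sub>F w in at 0. w \<noteq> (0::complex)" by (simp add: eventually_at_filter)
      then show ?thesis by eventually_elim (simp add: f_def field_simps)
    qed
    ultimately have "(f \<longlongrightarrow> 0) (at 0)" using tendsto_cong by force
    then show "\<And>z. z \<in> {0} \<Longrightarrow> (f \<longlongrightarrow> f z) (at z within ball 0 e)"
      using e(1) by (auto simp: f_def at_within_open[of _ "ball 0 e"])
  qed auto
  ultimately have "open (f ` ball 0 e)"
    by (intro open_mapping_thm3) auto
  moreover have "0 \<in> f ` ball 0 e" using e(1) by (auto simp: f_def image_iff)
  ultimately obtain e' where e': "e' > 0" "ball 0 e' \<subseteq> f ` ball 0 e"
    using openE by blast
  have "norm (\<Phi> z) \<le> 1 / e'" if z: "z \<in> outside T" "norm z \<le> R" for z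
  proof (rule ccontr)
    assume "\<not> norm (\<Phi> z) \<le> 1 / e'"
    then have "norm (1 / \<Phi> z) < e'"
      using e'(1) exterior_map_norm_gt_1[OF z(1)] by (simp add: norm_divide divide_less_eq mult.commute not_le)
    then obtain w where w: "w \<in> ball 0 e" "1 / \<Phi> z = f w" using e'(2) by fastforce
    have "\<Phi> z \<noteq> 0" using exterior_map_norm_gt_1[OF z(1)] by auto
    then have w0: "w \<noteq> 0" "\<Phi> z = \<Phi> (1 / w)"
      using w(2) by (auto simp: f_def split: if_splits)
    then have "z = 1 / w"
      using exterior_map_inj[of z "1 / w"] out[of w] w(1) z(1) by simp
    then have "norm z \<ge> 1 / e"
      using w(1) w0 e(1) by (simp add: norm_divide frac_le)
    then show False using e(3) z(2) by simp
  qed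
  then show ?thesis by blast
qed

lemma exterior_map_boundary:
  assumes "\<zeta> \<in> T"
  shows "((\<lambda>z. norm (\<Phi> z)) \<longlongrightarrow> 1) (at \<zeta> within outside T)"
proof (rule order_tendstoI)
  fix s :: real assume "s < 1"
  have "\<forall>\<^sub>F z in at \<zeta> within outside T. z \<in> outside T"
    by (simp add: eventually_at_filter)
  then show "\<forall>\<^sub>F z in at \<zeta> within outside T. s < norm (\<Phi> z)"
    by (rule eventually_mono) (use exterior_map_norm_gt_1 \<open>s < 1\<close> in force)
next
  fix s :: real assume "1 < s"
  have im: "\<Phi> ` outside T = {w. norm w > 1}" and inj: "inj_on \<Phi> (outside T)"
    using exterior_map_bij by (auto simp: bij_betw_def)
  obtain \<Psi> where \<Psi>: "\<Psi> holomorphic_on {w. norm w > 1}" "\<And>z. z \<in> outside T \<Longrightarrow> \<Psi> (\<Phi> z) = z"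
    using holomorphic_has_inverse[OF exterior_map_holomorphic open_outside_compact[OF comT] inj]
    unfolding im by metis
  obtain S where S: "\<And>z. z \<in> outside T \<Longrightarrow> norm z \<le> norm \<zeta> + 1 \<Longrightarrow> norm (\<Phi> z) \<le> S"
    using exterior_map_bounded by blast
  define K :: "complex set" where "K = {w. s \<le> norm w \<and> norm w \<le> S}"
  have "K = cball 0 S - ball 0 s" by (auto simp: K_def)
  then have "compact K" by (simp add: compact_diff)
  moreover have K1: "K \<subseteq> {w. norm w > 1}" using \<open>1 < s\<close> by (auto simp: K_def)
  ultimately have "compact (\<Psi> ` K)"
    using \<Psi>(1) by (intro compact_continuous_image) (blast intro: continuous_on_subset holomorphic_on_imp_continuous_on)+
  then have "closed (\<Psi> ` K)" by (rule compact_imp_closed)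
  moreover have "\<Psi> ` K \<subseteq> outside T"
    using K1 \<Psi>(2) unfolding im[symmetric] by fastforce
  then have "\<zeta> \<notin> \<Psi> ` K" using assms outside_no_overlap[of T] by blast
  ultimately have "\<forall>\<^sub>F z in nhds \<zeta>. z \<in> - \<Psi> ` K \<inter> ball \<zeta> 1"
    by (intro eventually_nhds_in_open) auto
  then have "\<forall>\<^sub>F z in at \<zeta> within outside T. z \<in> - \<Psi> ` K \<inter> ball \<zeta> 1 \<and> z \<in> outside T"
    by (auto simp: eventually_at_filter elim: eventually_mono)
  then show "\<forall>\<^sub>F z in at \<zeta> within outside T. norm (\<Phi> z) < s"
  proof eventually_elim
    case (elim z)
    have "norm z \<le> norm \<zeta> + 1"
      using elim norm_triangle_sub[of z \<zeta>] by (simp add: dist_norm norm_minus_commute)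
    then have "norm (\<Phi> z) \<le> S" using S elim by blast
    moreover have "\<Phi> z \<notin> K" using elim \<Psi>(2)[of z] by (metis ComplD Int_iff image_eqI)
    ultimately show ?case by (simp add: K_def)
  qed
qed

end

section \<open>Green's function with pole at infinity\<close>

lemma second_derivative_local_max:
  fixes \<phi> \<phi>' :: "real \<Rightarrow> real"
  assumes d: "d > 0" and 1: "\<And>s. \<bar>s\<bar> < d \<Longrightarrow> (\<phi> has_real_derivative \<phi>' s) (at s)"
    and 2: "(\<phi>' has_real_derivative D) (at 0)"
    and max: "\<And>s. \<bar>s\<bar> < d \<Longrightarrow> \<phi> s \<le> \<phi> 0"
  shows "D \<le> 0"
proof (rule ccontr)
  assume "\<not> D \<le> 0"
  have "\<phi>' 0 = 0"
    by (rule DERIV_local_max[OF 1 d]) (use d max in auto)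
  obtain e where e: "e > 0" "\<And>h. 0 < h \<Longrightarrow> h < e \<Longrightarrow> \<phi>' 0 < \<phi>' (0 + h)"
    using DERIV_pos_inc_right[OF 2] \<open>\<not> D \<le> 0\<close> by auto
  define h where "h = min d e / 2"
  have h: "0 < h" "h < d" "h < e" using d e(1) by (auto simp: h_def)
  have "\<phi> 0 < \<phi> h"
  proof (rule DERIV_pos_imp_increasing_open[OF h(1)])
    show "\<exists>y. (\<phi> has_real_derivative y) (at x) \<and> 0 < y" if "0 < x" "x < h" for x
      using 1[of x] e(2)[of x] that h \<open>\<phi>' 0 = 0\<close> by force
    show "continuous_on {0..h} \<phi>"
      by (intro continuous_at_imp_continuous_on ballI DERIV_isCont[OF 1]) (use h in auto)
  qed
  then show False using max[of h] h by simp
qed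

text \<open>The perturbation by a multiple of the squared norm makes the Laplacian strictly positive,
  which the second derivative test excludes at an interior maximum.\<close>

lemma harmonic_on_nonpos:
  assumes har: "harmonic_on u S" and com: "\<And>\<eta>. \<eta> > 0 \<Longrightarrow> compact {z\<in>S. u z \<ge> \<eta>}"
    and p: "p \<in> S"
  shows "u p \<le> 0"
proof (rule ccontr)
  assume "\<not> u p \<le> 0"
  define \<eta> where "\<eta> = u p / 2"
  have \<eta>: "0 < \<eta>" "\<eta> < u p" using \<open>\<not> u p \<le> 0\<close> by (auto simp: \<eta>_def)
  define K where "K = {z\<in>S. u z \<ge> \<eta>}"
  have K: "compact K" "p \<in> K" using com \<eta> p by (auto simp: K_def)
  obtain ux uy uxx uxy uyx uyy where S: "open S" and D: "\<And>z. z \<in> S \<Longrightarrow>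
           (u has_derivative (\<lambda>h. ux z * Re h + uy z * Im h)) (at z) \<and>
           (ux has_derivative (\<lambda>h. uxx z * Re h + uxy z * Im h)) (at z) \<and>
           (uy has_derivative (\<lambda>h. uyx z * Re h + uyy z * Im h)) (at z) \<and>
           uxx z + uyy z = (0::real)"
    using har unfolding harmonic_on_def by blast
  obtain B where B: "B > 0" "\<And>z. z \<in> K \<Longrightarrow> norm z \<le> B"
    using compact_imp_bounded[OF K(1)] bounded_pos by metis
  \<comment> \<open>On \<open>K\<close> the perturbation is at most \<open>\<eta> / 2\<close>. Since
    \<open>u p = 2 * \<eta>\<close>, a maximum point \<open>q\<close> of the perturbed function
    still has \<open>u q > \<eta>\<close>, so it is an interior point of \<open>K\<close>.\<close>
  define \<delta> where "\<delta> = \<eta> / (2 * B\<^sup>2)"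
  have \<delta>: "\<delta> > 0" using \<eta> B by (simp add: \<delta>_def)
  define v where "v z = u z + \<delta> * ((Re z)\<^sup>2 + (Im z)\<^sup>2)" for z
  have cont_u: "continuous_on S u"
    using D has_derivative_continuous S by (metis continuous_at_imp_continuous_on)
  have "continuous_on K v"
    unfolding v_def using continuous_on_subset[OF cont_u, of K]
    by (intro continuous_intros) (auto simp: K_def)
  then obtain q where q: "q \<in> K" "\<And>z. z \<in> K \<Longrightarrow> v z \<le> v q"
    using continuous_attains_sup[OF K(1)] K(2) by blast
  have "u p \<le> v p" using \<delta> by (simp add: v_def)
  also have "v p \<le> v q" using q K by blast
  also have "v q = u q + \<delta> * (norm q)\<^sup>2" by (simp add: v_def cmod_power2)
  also have "\<dots> \<le> u q + \<delta> * B\<^sup>2"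
    using B(2)[OF q(1)] \<delta> by (intro add_left_mono mult_left_mono power_mono) auto
  also have "\<delta> * B\<^sup>2 = \<eta> / 2" using B by (simp add: \<delta>_def)
  finally have uq: "u q > \<eta>" using \<open>\<not> u p \<le> 0\<close> by (simp add: \<eta>_def)
  have qS: "q \<in> S" using q by (simp add: K_def)
  have "open (S \<inter> u -` {\<eta><..})"
    by (rule continuous_open_preimage[OF cont_u S open_greaterThan])
  moreover have "q \<in> S \<inter> u -` {\<eta><..}" using uq qS by simp
  ultimately obtain d where d: "d > 0" "ball q d \<subseteq> S \<inter> u -` {\<eta><..}"
    by (rule openE)
  have locmax: "v z \<le> v q" if "z \<in> ball q d" for z
    using q(2) d(2) that by (force simp: K_def)
  have dx: "uxx q + 2 * \<delta> \<le> 0"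
  proof (rule second_derivative_local_max[OF d(1)])
    let ?l = "\<lambda>s::real. q + of_real s"
    show "v (?l s) \<le> v (?l 0)" if "\<bar>s\<bar> < d" for s
      using locmax[of "?l s"] that by (simp add: dist_norm)
    have l: "(?l has_derivative (\<lambda>h. of_real h)) (at s)" for s
      by (auto intro!: derivative_eq_intros)
    have chain: "((\<lambda>s. f (?l s)) has_real_derivative a) (at s)"
      if "(f has_derivative (\<lambda>h. a * Re h + b * Im h)) (at (?l s))" for f a b s
      using has_derivative_compose[OF l that] by (simp add: has_field_derivative_def)
    show "((\<lambda>s. v (?l s)) has_real_derivative ux (?l s) + 2 * \<delta> * (Re q + s)) (at s)" if "\<bar>s\<bar> < d" for s
    proof -
      have "?l s \<in> S" using d(2) that by (auto simp: dist_norm subset_iff)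
      from chain[OF D[OF this, THEN conjunct1]] show ?thesis
        unfolding v_def by (auto intro!: derivative_eq_intros)
    qed
    have "((\<lambda>s. ux (?l s)) has_real_derivative uxx q) (at 0)"
      using chain[of ux "uxx q" "uxy q" 0] D[OF qS] by simp
    then show "((\<lambda>s. ux (?l s) + 2 * \<delta> * (Re q + s)) has_real_derivative uxx q + 2 * \<delta>) (at 0)"
      by (auto intro!: derivative_eq_intros)
  qed
  have dy: "uyy q + 2 * \<delta> \<le> 0"
  proof (rule second_derivative_local_max[OF d(1)])
    let ?l = "\<lambda>s::real. q + \<i> * of_real s"
    show "v (?l s) \<le> v (?l 0)" if "\<bar>s\<bar> < d" for s
      using locmax[of "?l s"] that by (simp add: dist_norm norm_mult)
    have l: "(?l has_derivative (\<lambda>h. \<i> * of_real h)) (at s)" for s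
      by (auto intro!: derivative_eq_intros)
    have chain: "((\<lambda>s. f (?l s)) has_real_derivative b) (at s)"
      if "(f has_derivative (\<lambda>h. a * Re h + b * Im h)) (at (?l s))" for f a b s
      using has_derivative_compose[OF l that] by (simp add: has_field_derivative_def)
    show "((\<lambda>s. v (?l s)) has_real_derivative uy (?l s) + 2 * \<delta> * (Im q + s)) (at s)" if "\<bar>s\<bar> < d" for s
    proof -
      have "?l s \<in> S" using d(2) that by (auto simp: dist_norm norm_mult subset_iff)
      from chain[OF D[OF this, THEN conjunct1]] show ?thesis
        unfolding v_def by (auto intro!: derivative_eq_intros)
    qed
    have "((\<lambda>s. uy (?l s)) has_real_derivative uyy q) (at 0)"
      using chain[of uy "uyx q" "uyy q" 0] D[OF qS] by simp
    then show "((\<lambda>s. uy (?l s) + 2 * \<delta> * (Im q + s)) has_real_derivative uyy q + 2 * \<delta>) (at 0)"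
      by (auto intro!: derivative_eq_intros)
  qed
  show False using dx dy D[OF qS] \<delta> by linarith
qed

lemma harmonic_on_lincomb:
  assumes "harmonic_on u S" "harmonic_on v S"
  shows "harmonic_on (\<lambda>z. a * u z + b * v z) S"
proof -
  obtain ux uy uxx uxy uyx uyy where U: "open S"
        "continuous_on S uxx" "continuous_on S uxy" "continuous_on S uyx" "continuous_on S uyy"
        "\<And>z. z \<in> S \<Longrightarrow>
           (u has_derivative (\<lambda>h. ux z * Re h + uy z * Im h)) (at z) \<and>
           (ux has_derivative (\<lambda>h. uxx z * Re h + uxy z * Im h)) (at z) \<and>
           (uy has_derivative (\<lambda>h. uyx z * Re h + uyy z * Im h)) (at z) \<and>
           uxx z + uyy z = (0::real)"
    using assms(1) unfolding harmonic_on_def by blast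
  obtain vx vy vxx vxy vyx vyy where V:
        "continuous_on S vxx" "continuous_on S vxy" "continuous_on S vyx" "continuous_on S vyy"
        "\<And>z. z \<in> S \<Longrightarrow>
           (v has_derivative (\<lambda>h. vx z * Re h + vy z * Im h)) (at z) \<and>
           (vx has_derivative (\<lambda>h. vxx z * Re h + vxy z * Im h)) (at z) \<and>
           (vy has_derivative (\<lambda>h. vyx z * Re h + vyy z * Im h)) (at z) \<and>
           vxx z + vyy z = (0::real)"
    using assms(2) unfolding harmonic_on_def by blast
  have lin: "((\<lambda>z. a * f z + b * g z) has_derivative
          (\<lambda>h. (a * p + b * r) * Re h + (a * q + b * s) * Im h)) (at z)"
    if "(f has_derivative (\<lambda>h. p * Re h + q * Im h)) (at z)"
       "(g has_derivative (\<lambda>h. r * Re h + s * Im h)) (at z)" for f g p q r s z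
    by (rule has_derivative_eq_rhs[OF has_derivative_add[OF
         has_derivative_mult_right[OF that(1)] has_derivative_mult_right[OF that(2)]]])
      (auto simp: algebra_simps)
  show ?thesis
    unfolding harmonic_on_def
  proof (intro conjI exI ballI)
    fix z assume z: "z \<in> S"
    show "((\<lambda>z. a * u z + b * v z) has_derivative
        (\<lambda>h. (a * ux z + b * vx z) * Re h + (a * uy z + b * vy z) * Im h)) (at z)"
      using U(6)[OF z] V(5)[OF z] by (intro lin) auto
    show "((\<lambda>z. a * ux z + b * vx z) has_derivative
        (\<lambda>h. (a * uxx z + b * vxx z) * Re h + (a * uxy z + b * vxy z) * Im h)) (at z)"
      using U(6)[OF z] V(5)[OF z] by (intro lin) auto
    show "((\<lambda>z. a * uy z + b * vy z) has_derivative
        (\<lambda>h. (a * uyx z + b * vyx z) * Re h + (a * uyy z + b * vyy z) * Im h)) (at z)"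
      using U(6)[OF z] V(5)[OF z] by (intro lin) auto
    have "a * uxx z + b * vxx z + (a * uyy z + b * vyy z) = a * (uxx z + uyy z) + b * (vxx z + vyy z)"
      by (simp add: algebra_simps)
    then show "a * uxx z + b * vxx z + (a * uyy z + b * vyy z) = 0"
      using U(6)[OF z] V(5)[OF z] by simp
  qed (use U V in \<open>auto intro!: continuous_intros\<close>)
qed

text \<open>The gradient of \<open>ln (norm (f z))\<close> is read off from the logarithmic
  derivative \<open>q\<close>, as the pair of \<open>Re (q z)\<close> and \<open>- Im (q z)\<close>.
  This is globally defined, so no branch of the logarithm is chosen, and the Cauchy-Riemann
  equations for \<open>q\<close> make the Laplacian vanish.\<close>

lemma harmonic_on_ln_norm:
  assumes hol: "f holomorphic_on S" and S: "open S" and nz: "\<And>z. z \<in> S \<Longrightarrow> f z \<noteq> 0"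
  shows "harmonic_on (\<lambda>z. ln (norm (f z))) S"
proof -
  define q where "q z = deriv f z / f z" for z
  have q: "q holomorphic_on S"
    unfolding q_def using hol S nz by (intro holomorphic_intros) auto
  have cont: "continuous_on S (deriv q)"
    using q S by (intro holomorphic_on_imp_continuous_on holomorphic_deriv)
  have dq: "(q has_derivative (\<lambda>h. deriv q z * h)) (at z)" if "z \<in> S" for z
    using holomorphic_derivI[OF q S that] by (simp add: has_field_derivative_def)
  show ?thesis
    unfolding harmonic_on_def
  proof (intro conjI exI ballI)
    fix z assume z: "z \<in> S"
    have "(f has_derivative (\<lambda>h. deriv f z * h)) (at z)"
      using holomorphic_derivI[OF hol S z] by (simp add: has_field_derivative_def)
    from has_derivative_compose[OF this, of norm "\<lambda>h. h \<bullet> sgn (f z)"]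
    have n: "((\<lambda>z. norm (f z)) has_derivative (\<lambda>h. (deriv f z * h) \<bullet> sgn (f z))) (at z)"
      using has_derivative_norm[OF nz[OF z]] by simp
    have "((\<lambda>z. ln (norm (f z))) has_derivative
        (\<lambda>h. (sgn (f z) \<bullet> (deriv f z * h)) / norm (f z))) (at z)"
      using nz[OF z] by (auto intro!: derivative_eq_intros n simp: divide_inverse inner_commute)
    also have "(\<lambda>h. (sgn (f z) \<bullet> (deriv f z * h)) / norm (f z)) = (\<lambda>h. Re (q z * h))"
    proof
      fix h
      have "q z * h = cnj (f z) * (deriv f z * h) / (norm (f z))\<^sup>2"
        using nz[OF z] complex_norm_square[of "f z"] by (simp add: q_def field_simps)
      then have "Re (q z * h) = Re (cnj (f z) * (deriv f z * h)) / (norm (f z))\<^sup>2"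
        by (metis Re_divide_of_real of_real_power)
      then show "(sgn (f z) \<bullet> (deriv f z * h)) / norm (f z) = Re (q z * h)"
        by (simp add: sgn_div_norm inner_complex_def power2_eq_square divide_inverse algebra_simps)
    qed
    also have "\<dots> = (\<lambda>h. Re (q z) * Re h + (- Im (q z)) * Im h)" by auto
    finally show "((\<lambda>z. ln (norm (f z))) has_derivative
        (\<lambda>h. Re (q z) * Re h + (- Im (q z)) * Im h)) (at z)" .
    show "((\<lambda>z. Re (q z)) has_derivative
        (\<lambda>h. Re (deriv q z) * Re h + (- Im (deriv q z)) * Im h)) (at z)"
      by (rule has_derivative_eq_rhs[OF has_derivative_Re[OF dq[OF z]]]) auto
    show "((\<lambda>z. - Im (q z)) has_derivative
        (\<lambda>h. (- Im (deriv q z)) * Re h + (- Re (deriv q z)) * Im h)) (at z)"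
      by (rule has_derivative_eq_rhs[OF has_derivative_minus[OF has_derivative_Im[OF dq[OF z]]]]) auto
  qed (use cont S in \<open>auto intro!: continuous_intros\<close>)
qed

section \<open>Uniqueness and existence of the Green function\<close>

definition is_green :: "complex set \<Rightarrow> (complex \<Rightarrow> real) \<Rightarrow> bool" where
  "is_green T H \<longleftrightarrow>
     harmonic_on H (outside T) \<and>
     (\<forall>\<zeta>\<in>T. (H \<longlongrightarrow> 0) (at \<zeta> within outside T)) \<and>
     H \<sim>[at_infinity] (\<lambda>z. 1 / pi * ln (norm z)) \<and>
     (\<forall>z. z \<notin> outside T \<longrightarrow> H z = 0)"

lemma harmonic_on_imp_continuous_on: "harmonic_on u S \<Longrightarrow> continuous_on S u"
  unfolding harmonic_on_def by (metis continuous_at_imp_continuous_on has_derivative_continuous)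

text \<open>Turns boundary behaviour at \<open>T\<close> and at infinity into the compactness that
  \<open>harmonic_on_nonpos\<close> asks for. A limit point cannot lie in a hole of
  \<open>T\<close>, which is open and disjoint from the exterior, nor on \<open>T\<close>, where
  \<open>bd\<close> applies.\<close>

lemma compact_superlevel_set:
  fixes T :: "complex set" and u :: "complex \<Rightarrow> real"
  assumes T: "compact T" and cont: "continuous_on (outside T) u"
    and bd: "\<And>\<zeta>. \<zeta> \<in> T \<Longrightarrow> \<forall>\<^sub>F z in at \<zeta> within outside T. u z < \<eta>"
    and inf: "\<forall>\<^sub>F z in at_infinity. u z < \<eta>"
  shows "compact {z\<in>outside T. u z \<ge> \<eta>}" (is "compact ?A")
proof -
  obtain R where "\<And>z. norm z \<ge> R \<Longrightarrow> u z < \<eta>"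
    using inf unfolding eventually_at_infinity by blast
  note R = this
  have "norm z \<le> R" if "z \<in> ?A" for z
  proof (rule ccontr)
    assume "\<not> norm z \<le> R"
    then have "u z < \<eta>" by (intro R) simp
    then show False using that by simp
  qed
  then have "bounded ?A" by (rule boundedI)
  moreover have "x \<in> ?A" if x: "x \<in> closure ?A" for x
  proof -
    have meet: "N \<inter> ?A \<noteq> {}" if "open N" "x \<in> N" for N
      using x that open_Int_closure_eq_empty[OF that(1), of ?A] by blast
    have "inside T \<inter> ?A = {}" using inside_Int_outside[of T] by blast
    moreover have "open (inside T)" using T by (simp add: open_inside compact_imp_closed)
    ultimately have "x \<notin> inside T" using meet by blast
    moreover have "x \<notin> T"
    proof
      assume "x \<in> T"
      then obtain N where N: "open N" "x \<in> N" "\<And>z. z \<in> N \<Longrightarrow> z \<noteq> x \<Longrightarrow> z \<in> outside T \<Longrightarrow> u z < \<eta>"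
        using bd unfolding eventually_at_topological by metis
      then obtain z where "z \<in> N" "z \<in> ?A" using meet by blast
      moreover have "z \<noteq> x" using \<open>x \<in> T\<close> \<open>z \<in> ?A\<close> outside_no_overlap[of T] by blast
      ultimately show False using N(3)[of z] by simp
    qed
    ultimately have xo: "x \<in> outside T" using inside_Un_outside[of T] by blast
    have "open (outside T \<inter> u -` {..<\<eta>})"
      by (rule continuous_open_preimage[OF cont open_outside_compact[OF T] open_lessThan])
    moreover have "(outside T \<inter> u -` {..<\<eta>}) \<inter> ?A = {}" by auto
    ultimately have "x \<notin> outside T \<inter> u -` {..<\<eta>}" using meet by blast
    then show ?thesis using xo by simp
  qed
  then have "closed ?A" using closure_subset_eq by blast
  ultimately show ?thesis using compact_eq_bounded_closed by blast
qed

lemma ln_norm_at_top: "filterlim (\<lambda>z::complex. ln (norm z)) at_top at_infinity"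
  by (rule filterlim_compose[OF ln_at_top filterlim_norm_at_top])

lemma is_green_ratio:
  assumes "is_green T H"
  shows "((\<lambda>z. H z / (1 / pi * ln (norm z))) \<longlongrightarrow> 1) at_infinity"
proof -
  have "\<forall>\<^sub>F z::complex in at_infinity. ln (norm z) > 0"
    using ln_norm_at_top by (simp add: filterlim_at_top_dense)
  then have "\<forall>\<^sub>F z in at_infinity. H z \<noteq> 0 \<or> 1 / pi * ln (norm z) \<noteq> 0"
    by eventually_elim auto
  then show ?thesis
    using assms asymp_equivD_strong unfolding is_green_def by blast
qed

text \<open>The combination tends to 0 at \<open>T\<close>, and divided by the logarithm it tends to
  \<open>a + b < 0\<close> at infinity. So it is eventually negative there, and the maximum
  principle applies.\<close>

lemma is_green_lincomb_nonpos:
  assumes T: "compact T" and G: "is_green T H" "is_green T K"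
    and ab: "a + b < 0" and z: "z \<in> outside T"
  shows "a * H z + b * K z \<le> 0"
proof (rule harmonic_on_nonpos[OF _ _ z])
  show har: "harmonic_on (\<lambda>z. a * H z + b * K z) (outside T)"
    using G by (intro harmonic_on_lincomb) (auto simp: is_green_def)
  fix \<eta> :: real assume \<eta>: "\<eta> > 0"
  let ?L = "\<lambda>z::complex. 1 / pi * ln (norm z)"
  show "compact {z \<in> outside T. \<eta> \<le> a * H z + b * K z}"
  proof (rule compact_superlevel_set[OF T harmonic_on_imp_continuous_on[OF har]])
    fix \<zeta> assume "\<zeta> \<in> T"
    then have "((\<lambda>z. a * H z + b * K z) \<longlongrightarrow> a * 0 + b * 0) (at \<zeta> within outside T)"
      using G by (intro tendsto_intros) (auto simp: is_green_def)
    then show "\<forall>\<^sub>F z in at \<zeta> within outside T. a * H z + b * K z < \<eta>"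
      using \<eta> by (intro order_tendstoD(2)) auto
  next
    have "((\<lambda>z. a * (H z / ?L z) + b * (K z / ?L z)) \<longlongrightarrow> a * 1 + b * 1) at_infinity"
      by (intro tendsto_intros is_green_ratio[OF G(1)] is_green_ratio[OF G(2)])
    then have "\<forall>\<^sub>F z in at_infinity. a * (H z / ?L z) + b * (K z / ?L z) < 0"
      using ab by (intro order_tendstoD(2)) auto
    moreover have "\<forall>\<^sub>F z::complex in at_infinity. ln (norm z) > 0"
      using ln_norm_at_top by (simp add: filterlim_at_top_dense)
    ultimately show "\<forall>\<^sub>F z in at_infinity. a * H z + b * K z < \<eta>"
    proof eventually_elim
      case (elim z)
      then have "?L z > 0" by simp
      moreover have "a * (H z / ?L z) + b * (K z / ?L z) = (a * H z + b * K z) / ?L z"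
        by (simp only: add_divide_distrib times_divide_eq_right)
      ultimately have "a * H z + b * K z < 0" using elim by (metis divide_less_0_iff not_less_iff_gr_or_eq)
      then show ?case using \<eta> by simp
    qed
  qed
qed

text \<open>Asymptotic equivalence makes \<open>H - K\<close> only little-o of the logarithm, which
  gives no sign at infinity. Comparing \<open>H\<close> with \<open>(1 + e) * K\<close> creates the
  negative sum of coefficients; then \<open>e\<close> tends to 0.\<close>

lemma is_green_le:
  assumes T: "compact T" and G: "is_green T H" "is_green T K" and z: "z \<in> outside T"
  shows "H z \<le> K z"
proof -
  have "H z - K z \<le> e * \<bar>K z\<bar>" if "e > 0" for e
  proof -
    have "1 * H z + (- (1 + e)) * K z \<le> 0"
      by (rule is_green_lincomb_nonpos[OF T G _ z]) (use that in simp)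
    also have "e * K z \<le> e * \<bar>K z\<bar>" using that by (intro mult_left_mono) auto
    then have "1 * H z + (- (1 + e)) * K z \<ge> H z - K z - e * \<bar>K z\<bar>" by (simp add: algebra_simps)
    finally show ?thesis by simp
  qed
  note le = this
  show ?thesis
  proof (rule field_le_epsilon)
    fix e :: real assume "e > 0"
    have "H z - K z \<le> e / (\<bar>K z\<bar> + 1) * \<bar>K z\<bar>" using \<open>e > 0\<close> by (intro le) simp
    also have "\<dots> \<le> e" using \<open>e > 0\<close> by (simp add: field_simps)
    finally show "H z \<le> K z + e" by simp
  qed
qed

lemma is_green_unique:
  assumes "compact T" "is_green T H" "is_green T K"
  shows "H = K"
proof
  fix z show "H z = K z"
    using is_green_le[OF assms] is_green_le[OF assms(1,3,2)] assms
    by (cases "z \<in> outside T") (auto simp: is_green_def intro: order_antisym)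
qed

context
  fixes T \<Phi> c
  assumes ext: "is_exterior_map T \<Phi> c" and comT: "compact T"
begin

lemma exterior_map_ln_asymp:
  "((\<lambda>z. ln (norm (\<Phi> z)) - ln (norm z)) \<longlongrightarrow> ln c) at_infinity"
proof -
  have "((\<lambda>z. ln (norm (\<Phi> z / z))) \<longlongrightarrow> ln (norm (complex_of_real c))) at_infinity"
    using exterior_map_pos[OF ext comT] by (intro tendsto_intros exterior_map_lim[OF ext comT]) auto
  moreover have "\<forall>\<^sub>F z in at_infinity. ln (norm (\<Phi> z / z)) = ln (norm (\<Phi> z)) - ln (norm z)"
    using eventually_in_outside[OF comT] eventually_not_equal_at_infinity[of 0]
  proof eventually_elim
    case (elim z)
    have "norm (\<Phi> z) > 0" using exterior_map_norm_gt_1[OF ext comT, of z] elim by linarith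
    then have "\<Phi> z \<noteq> 0" by auto
    then show ?case using elim by (simp add: norm_divide ln_div)
  qed
  ultimately have "((\<lambda>z. ln (norm (\<Phi> z)) - ln (norm z)) \<longlongrightarrow> ln (norm (complex_of_real c))) at_infinity"
    using tendsto_cong by force
  then show ?thesis using exterior_map_pos[OF ext comT] by simp
qed

lemma exterior_map_is_green:
  "is_green T (\<lambda>z. if z \<in> outside T then ln (norm (\<Phi> z)) / pi else 0)" (is "is_green T ?G")
  unfolding is_green_def
proof (intro conjI ballI allI impI)
  have "harmonic_on (\<lambda>z. ln (norm (\<Phi> z))) (outside T)"
    using exterior_map_norm_gt_1[OF ext comT]
    by (intro harmonic_on_ln_norm exterior_map_holomorphic[OF ext comT] open_outside_compact comT) force
  from harmonic_on_lincomb[OF this this, of "1 / pi" 0]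
  have "harmonic_on (\<lambda>z. ln (norm (\<Phi> z)) / pi) (outside T)" by simp
  moreover have "harmonic_on g S" if "harmonic_on f S" "\<And>z. z \<in> S \<Longrightarrow> f z = g z" for f g S
  proof -
    have "(g has_derivative D) (at z)" if "(f has_derivative D) (at z)" "z \<in> S" for D z
      using has_derivative_transform_within_open[OF that(1), of S] that(2)
        \<open>harmonic_on f S\<close> \<open>\<And>z. z \<in> S \<Longrightarrow> f z = g z\<close> by (auto simp: harmonic_on_def)
    then show ?thesis using that(1) unfolding harmonic_on_def by blast
  qed
  ultimately show "harmonic_on ?G (outside T)" by simp
next
  fix \<zeta> assume "\<zeta> \<in> T"
  then have "((\<lambda>z. ln (norm (\<Phi> z)) / pi) \<longlongrightarrow> ln 1 / pi) (at \<zeta> within outside T)"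
    by (intro tendsto_divide tendsto_ln tendsto_const exterior_map_boundary[OF ext comT]) auto
  moreover have "\<forall>\<^sub>F z in at \<zeta> within outside T. ln (norm (\<Phi> z)) / pi = ?G z"
    by (simp add: eventually_at_filter)
  ultimately have "(?G \<longlongrightarrow> ln 1 / pi) (at \<zeta> within outside T)"
    using tendsto_cong by force
  then show "(?G \<longlongrightarrow> 0) (at \<zeta> within outside T)" by simp
next
  let ?L = "\<lambda>z::complex. 1 / pi * ln (norm z)"
  have "((\<lambda>z. (ln (norm (\<Phi> z)) - ln (norm z)) / ln (norm z)) \<longlongrightarrow> 0) at_infinity"
    using exterior_map_ln_asymp
    by (rule real_tendsto_divide_at_top) (rule ln_norm_at_top)
  then have "((\<lambda>z. (ln (norm (\<Phi> z)) - ln (norm z)) / ln (norm z) + 1) \<longlongrightarrow> 0 + 1) at_infinity"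
    by (intro tendsto_intros)
  moreover have "\<forall>\<^sub>F z::complex in at_infinity. ln (norm z) > 0"
    using ln_norm_at_top by (simp add: filterlim_at_top_dense)
  then have "\<forall>\<^sub>F z in at_infinity. (ln (norm (\<Phi> z)) - ln (norm z)) / ln (norm z) + 1 = ?G z / ?L z"
    using eventually_in_outside[OF comT] by eventually_elim (simp add: field_simps)
  ultimately have "((\<lambda>z. ?G z / ?L z) \<longlongrightarrow> 0 + 1) at_infinity"
    using tendsto_cong by force
  then have "((\<lambda>z. ?G z / ?L z) \<longlongrightarrow> 1) at_infinity" by simp
  then show "?G \<sim>[at_infinity] ?L" by (rule asymp_equivI')
qed auto

end

text \<open>Both maps yield the same Green function, so their moduli agree. The quotient has modulus
  one and is constant by the maximum modulus principle; the limits at infinity identify the constant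
  as \<open>c / d\<close>, a positive number of modulus one.\<close>

lemma exterior_map_unique:
  assumes T: "compact T" and 1: "is_exterior_map T \<Phi> c" and 2: "is_exterior_map T \<Psi> d"
  shows "\<Phi> = \<Psi>"
proof -
  have "(\<lambda>z. if z \<in> outside T then ln (norm (\<Phi> z)) / pi else 0) =
        (\<lambda>z. if z \<in> outside T then ln (norm (\<Psi> z)) / pi else 0)"
    using exterior_map_is_green 1 2 T is_green_unique by blast
  then have h: "ln (norm (\<Phi> z)) / pi = ln (norm (\<Psi> z)) / pi" if "z \<in> outside T" for z
    using that by (metis (no_types, lifting))
  then have eq: "norm (\<Phi> z) = norm (\<Psi> z)" if "z \<in> outside T" for z
  proof -
    have "ln (norm (\<Phi> z)) = ln (norm (\<Psi> z))" using h[OF that] by simp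
    moreover have "norm (\<Phi> z) > 0" "norm (\<Psi> z) > 0"
      using exterior_map_norm_gt_1[OF 1 T that] exterior_map_norm_gt_1[OF 2 T that] by linarith+
    ultimately show ?thesis by simp
  qed
  let ?q = "\<lambda>z. \<Phi> z / \<Psi> z"
  have nz: "\<Psi> z \<noteq> 0" if "z \<in> outside T" for z
    using exterior_map_norm_gt_1[OF 2 T that] by auto
  have q1: "norm (?q z) = 1" if "z \<in> outside T" for z
    using eq[OF that] nz[OF that] by (simp add: norm_divide)
  obtain p where p: "p \<in> outside T"
    using eventually_in_outside[OF T] eventually_happens' trivial_limit_at_infinity by blast
  have "?q constant_on outside T"
  proof (rule maximum_modulus_principle[where U = "outside T" and \<xi> = p])
    show "?q holomorphic_on outside T"
      using nz by (intro holomorphic_intros exterior_map_holomorphic[OF 1 T] exterior_map_holomorphic[OF 2 T])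
    show "connected (outside T)"
      using T by (intro connected_outside compact_imp_bounded) auto
  qed (use p q1 open_outside_compact[OF T] in auto)
  then obtain k where k: "\<And>z. z \<in> outside T \<Longrightarrow> ?q z = k" by (auto simp: constant_on_def)
  have d: "d > 0" and c: "c > 0" using exterior_map_pos 1 2 T by blast+
  have "((\<lambda>z. (\<Phi> z / z) / (\<Psi> z / z)) \<longlongrightarrow> complex_of_real c / complex_of_real d) at_infinity"
    using d by (intro tendsto_intros exterior_map_lim[OF 1 T] exterior_map_lim[OF 2 T]) auto
  moreover have "\<forall>\<^sub>F z in at_infinity. (\<Phi> z / z) / (\<Psi> z / z) = k"
    using eventually_in_outside[OF T] eventually_not_equal_at_infinity[of 0]
    by eventually_elim (use k in auto)
  ultimately have "((\<lambda>z::complex. k) \<longlongrightarrow> complex_of_real c / complex_of_real d) at_infinity"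
    by (simp cong: tendsto_cong)
  then have kc: "k = complex_of_real (c / d)"
    using tendsto_unique[OF trivial_limit_at_infinity tendsto_const, of k] by simp
  moreover have "norm k = 1" using q1[OF p] k[OF p] by simp
  ultimately have "c / d = 1" using c d by (simp add: norm_divide)
  then have "k = 1" using kc by simp
  show ?thesis
  proof
    fix z show "\<Phi> z = \<Psi> z"
      using k[of z] nz[of z] \<open>k = 1\<close> 1 2 by (cases "z \<in> outside T") (auto simp: is_exterior_map_def)
  qed
qed

lemma exterior_map_eq:
  assumes T: "compact T" and ext: "is_exterior_map T \<Phi> c"
  shows "exterior_map T = \<Phi>"
  unfolding exterior_map_def
proof (rule the_equality)
  show "\<Phi> holomorphic_on outside T \<and> bij_betw \<Phi> (outside T) {w. 1 < norm w} \<and>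
    (\<exists>c>0. ((\<lambda>z. \<Phi> z / z) \<longlongrightarrow> complex_of_real c) at_infinity) \<and> (\<forall>z. z \<notin> outside T \<longrightarrow> \<Phi> z = 0)"
    using ext unfolding is_exterior_map_def by blast
next
  fix \<Psi>
  assume "\<Psi> holomorphic_on outside T \<and> bij_betw \<Psi> (outside T) {w. 1 < norm w} \<and>
    (\<exists>c>0. ((\<lambda>z. \<Psi> z / z) \<longlongrightarrow> complex_of_real c) at_infinity) \<and> (\<forall>z. z \<notin> outside T \<longrightarrow> \<Psi> z = 0)"
  then obtain d where "is_exterior_map T \<Psi> d" unfolding is_exterior_map_def by blast
  then show "\<Psi> = \<Phi>" using exterior_map_unique[OF T _ ext] by blast
qed

lemma conformal_radius_eq:
  assumes T: "compact T" and ext: "is_exterior_map T \<Phi> c"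
  shows "conformal_radius T = 1 / c"
  unfolding conformal_radius_def exterior_map_eq[OF T ext]
proof (rule the_equality)
  have "((\<lambda>z. inverse (\<Phi> z / z)) \<longlongrightarrow> inverse (complex_of_real c)) at_infinity"
    using exterior_map_pos[OF ext T] by (intro tendsto_intros exterior_map_lim[OF ext T]) auto
  then show *: "((\<lambda>z. z / \<Phi> z) \<longlongrightarrow> complex_of_real (1 / c)) at_infinity"
    by (simp add: divide_inverse mult.commute)
  show "r = 1 / c" if "((\<lambda>z. z / \<Phi> z) \<longlongrightarrow> complex_of_real r) at_infinity" for r
    using tendsto_unique[OF trivial_limit_at_infinity that *] of_real_eq_iff by blast
qed

lemma green_infinity_eq:
  assumes T: "compact T" and ext: "is_exterior_map T \<Phi> c"
  shows "green_infinity T = (\<lambda>z. if z \<in> outside T then ln (norm (\<Phi> z)) / pi else 0)"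
  unfolding green_infinity_def is_green_def[symmetric]
  using exterior_map_is_green[OF ext T] is_green_unique[OF T] by (intro the_equality) blast+

section \<open>Mean values and growth of the Green function\<close>

text \<open>On a disc a zero-free \<open>f\<close> has a holomorphic logarithm \<open>g\<close>, so
  that \<open>ln (norm (f z))\<close> is the real part of \<open>g z\<close>, and Cauchy's integral
  formula gives the mean of \<open>g\<close>.\<close>

lemma circle_mean_ln_norm:
  assumes hol: "f holomorphic_on ball w r" and nz: "\<And>z. z \<in> ball w r \<Longrightarrow> f z \<noteq> 0" and \<xi>: "norm \<xi> < r"
  shows "((\<lambda>x. ln (norm (f (w + \<xi> * exp (2 * of_real pi * \<i> * of_real x))))) has_integral ln (norm (f w))) {0..1}"
proof -
  have "simply_connected (ball w r)" by (simp add: convex_imp_simply_connected)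
  then obtain g where g: "g holomorphic_on ball w r" "\<And>z. z \<in> ball w r \<Longrightarrow> f z = exp (g z)"
    using simply_connected_eq_holomorphic_log[OF open_ball, of w r] hol nz by metis
  have ln_eq: "ln (norm (f z)) = Re (g z)" if "z \<in> ball w r" for z
    using g(2)[OF that] by simp
  have in_ball: "w + \<xi> * v \<in> ball w r" if "norm v \<le> 1" for v
    using \<xi> mult_left_mono[OF that, of "norm \<xi>"] by (simp add: dist_norm norm_mult)
  \<comment> \<open>The complex factor \<open>\<xi>\<close> encodes the radius and the starting
    angle at once, so the unit circle suffices.\<close>
  let ?F = "\<lambda>v. g (w + \<xi> * v)" and ?e = "\<lambda>x::real. exp (2 * of_real pi * \<i> * of_real x)"
  have "(g \<circ> (\<lambda>v. w + \<xi> * v)) holomorphic_on cball 0 1"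
    by (rule holomorphic_on_compose_gen[OF _ g(1)]) (use in_ball in \<open>auto intro!: holomorphic_intros\<close>)
  then have "?F holomorphic_on cball 0 1" by (simp add: o_def)
  from Cauchy_integral_circlepath_simple[OF this, of 0]
  have "((\<lambda>u. ?F u / u) has_contour_integral (2 * of_real pi * \<i> * g w)) (circlepath 0 1)"
    by simp
  then have "((\<lambda>x. ?F (?e x) / ?e x * (2 * of_real pi * \<i> * ?e x)) has_integral (2 * of_real pi * \<i> * g w)) {0..1}"
    unfolding has_contour_integral_def
    by (rule has_integral_eq[rotated]) (subst vector_derivative_circlepath01; simp add: circlepath)
  then have "((\<lambda>x. (2 * of_real pi * \<i>) * ?F (?e x)) has_integral (2 * of_real pi * \<i> * g w)) {0..1}"
    by (simp add: mult_ac)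
  from has_integral_mult_right[OF this, of "inverse (2 * of_real pi * \<i>)"]
  have "((\<lambda>x. ?F (?e x)) has_integral g w) {0..1}"
    by (simp add: field_simps)
  then have "((\<lambda>x. Re (?F (?e x))) has_integral Re (g w)) {0..1}"
    by (rule has_integral_Re)
  moreover have "norm (?e x) \<le> 1" for x by simp
  ultimately show ?thesis
    using ln_eq[OF in_ball] ln_eq[of w] \<xi> by (simp add: le_less_trans[OF norm_ge_zero])
qed

text \<open>All that the probabilistic part knows about the Green function. The zero set is
  \<open>T\<close> with its holes filled; the circle means stand for harmonicity; the last two
  clauses say that \<open>pi * H\<close> differs from the logarithm by a bounded amount, with
  \<open>max 1\<close> keeping the upper one meaningful near the origin.\<close>

locale green_function =
  fixes H :: "complex \<Rightarrow> real" and C R\<^sub>0 :: real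
  assumes cont: "continuous_on UNIV H"
    and nonneg: "H w \<ge> 0"
    and compact_zero: "compact {w. H w = 0}"
    and circle_mean: "ball w r \<subseteq> {w. H w > 0} \<Longrightarrow> norm \<xi> < r \<Longrightarrow>
       ((\<lambda>x. H (w + \<xi> * exp (2 * of_real pi * \<i> * of_real x))) has_integral H w) {0..1}"
    and upper: "pi * H w \<le> C + ln (max 1 (norm w))"
    and lower: "norm w \<ge> R\<^sub>0 \<Longrightarrow> pi * H w \<ge> ln (norm w) - C"

lemma green_infinity_is_green_function:
  assumes T: "compact T" and ext: "is_exterior_map T \<Phi> c"
  shows "\<exists>C R\<^sub>0. green_function (green_infinity T) C R\<^sub>0"
    and "\<And>z. green_infinity T z > 0 \<longleftrightarrow> z \<in> outside T"
proof -
  define H where "H = green_infinity T"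
  have H: "H z = (if z \<in> outside T then ln (norm (\<Phi> z)) / pi else 0)" for z
    unfolding H_def green_infinity_eq[OF assms] ..
  have Phi: "norm (\<Phi> z) > 1" if "z \<in> outside T" for z
    by (rule exterior_map_norm_gt_1[OF ext T that])
  have pos: "H z > 0 \<longleftrightarrow> z \<in> outside T" for z
    using Phi[of z] by (auto simp: H intro!: divide_pos_pos ln_gt_zero)
  have green: "is_green T H"
    using exterior_map_is_green[OF ext T] unfolding H_def green_infinity_eq[OF assms] .
  have nonneg: "H z \<ge> 0" for z
    using pos[of z] by (cases "z \<in> outside T") (auto simp: H)
  have cont_out: "continuous_on (outside T) H"
    using green harmonic_on_imp_continuous_on is_green_def by blast
  have cont: "isCont H x" for x
  proof (cases "x \<in> outside T")
    case True
    then show ?thesis using cont_out open_outside_compact[OF T] continuous_on_eq_continuous_at by blast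
  next
    case False
    \<comment> \<open>As \<open>H\<close> is nonnegative, continuity at a zero needs only this
      one-sided bound. On \<open>T\<close> it is the boundary condition; in a hole of
      \<open>T\<close> the function is locally 0.\<close>
    have "\<forall>\<^sub>F z in at x. H z < e" if "e > 0" for e
    proof (cases "x \<in> T")
      case True
      then have "\<forall>\<^sub>F z in at x within outside T. H z < e"
        using green that unfolding is_green_def by (blast intro: order_tendstoD(2))
      then have "\<forall>\<^sub>F z in nhds x. z \<noteq> x \<longrightarrow> z \<in> outside T \<longrightarrow> H z < e"
        by (simp add: eventually_at_filter)
      then show ?thesis
        unfolding eventually_at_filter by eventually_elim (use that in \<open>auto simp: H\<close>)
    next
      case False
      then have "x \<in> inside T" using \<open>x \<notin> outside T\<close> inside_Un_outside[of T] by blast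
      then have "\<forall>\<^sub>F z in nhds x. z \<in> inside T"
        using T by (intro eventually_nhds_in_open) (auto simp: open_inside compact_imp_closed)
      then show ?thesis
        unfolding eventually_at_filter
      proof eventually_elim
        case (elim z)
        then have "z \<notin> outside T" using inside_Int_outside[of T] by blast
        then show ?case using that by (simp add: H)
      qed
    qed
    then have "(H \<longlongrightarrow> 0) (at x)"
      using nonneg by (intro order_tendstoI) (auto intro: always_eventually less_le_trans)
    then show ?thesis using False by (simp add: isCont_def H)
  qed
  have contH: "continuous_on UNIV H"
    using cont by (simp add: continuous_at_imp_continuous_on)
  have zero: "{w. H w = 0} = - outside T"
    using pos nonneg by (auto simp: less_le)
  have compact_zero: "compact {w. H w = 0}"
    unfolding zero using T open_outside_compact[OF T] cobounded_outside[of T]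
    by (simp add: compact_eq_bounded_closed closed_Compl)
  have mean: "((\<lambda>x. H (w + \<xi> * exp (2 * of_real pi * \<i> * of_real x))) has_integral H w) {0..1}"
    if b: "ball w r \<subseteq> {w. H w > 0}" and \<xi>: "norm \<xi> < r" for w \<xi> r
  proof -
    have sub: "ball w r \<subseteq> outside T" using b pos by auto
    have "((\<lambda>x. ln (norm (\<Phi> (w + \<xi> * exp (2 * of_real pi * \<i> * of_real x))))) has_integral ln (norm (\<Phi> w))) {0..1}"
    proof (rule circle_mean_ln_norm[OF _ _ \<xi>])
      show "\<Phi> holomorphic_on ball w r"
        using sub exterior_map_holomorphic[OF ext T] holomorphic_on_subset by blast
      show "\<Phi> z \<noteq> 0" if "z \<in> ball w r" for z
        using that sub Phi[of z] by force
    qed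
    from has_integral_divide[OF this, of pi]
    have "((\<lambda>x. ln (norm (\<Phi> (w + \<xi> * exp (2 * of_real pi * \<i> * of_real x)))) / pi) has_integral ln (norm (\<Phi> w)) / pi) {0..1}" .
    moreover have "w + \<xi> * exp (2 * of_real pi * \<i> * of_real x) \<in> outside T" for x
      using \<xi> by (intro subsetD[OF sub]) (simp add: dist_norm norm_mult)
    moreover have "w \<in> outside T"
      using \<xi> norm_ge_zero[of \<xi>] by (intro subsetD[OF sub]) (simp del: norm_ge_zero)
    ultimately show ?thesis by (simp add: H)
  qed
  have "\<forall>\<^sub>F z in at_infinity. dist (ln (norm (\<Phi> z)) - ln (norm z)) (ln c) < 1"
    by (rule tendstoD[OF exterior_map_ln_asymp[OF ext T]]) simp
  then have "\<forall>\<^sub>F z in at_infinity. \<bar>pi * H z - ln (norm z)\<bar> \<le> \<bar>ln c\<bar> + 1"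
    using eventually_in_outside[OF T] by eventually_elim (auto simp: H dist_real_def)
  then obtain R where R: "\<And>z. norm z \<ge> R \<Longrightarrow> \<bar>pi * H z - ln (norm z)\<bar> \<le> \<bar>ln c\<bar> + 1"
    by (auto simp: eventually_at_infinity)
  have "bounded (H ` cball 0 (max 1 R))"
    by (intro compact_imp_bounded compact_continuous_image continuous_on_subset[OF contH]) auto
  then obtain B where B: "\<And>z. norm z \<le> max 1 R \<Longrightarrow> \<bar>H z\<bar> \<le> B"
    by (fastforce simp: bounded_iff)
  define C where "C = max (\<bar>ln c\<bar> + 1) (pi * B)"
  have up: "pi * H w \<le> C + ln (max 1 (norm w))" for w
  proof (cases "norm w \<le> max 1 R")
    case True
    then have "pi * H w \<le> pi * B" using B[of w] by simp
    moreover have "pi * B \<le> C" by (simp add: C_def)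
    moreover have "ln (max 1 (norm w)) \<ge> 0" by simp
    ultimately show ?thesis by linarith
  next
    case False
    then have "max 1 (norm w) = norm w" "norm w \<ge> R" by auto
    moreover have "\<bar>ln c\<bar> + 1 \<le> C" by (simp add: C_def)
    ultimately show ?thesis using R[of w] by simp
  qed
  have lo: "pi * H w \<ge> ln (norm w) - C" if "norm w \<ge> R" for w
  proof -
    have "\<bar>ln c\<bar> + 1 \<le> C" by (simp add: C_def)
    then show ?thesis using R[OF that] by linarith
  qed
  have "green_function H C R"
    by unfold_locales (use contH nonneg compact_zero mean up lo in auto)
  then show "\<exists>C R\<^sub>0. green_function (green_infinity T) C R\<^sub>0" unfolding H_def by blast
  show "\<And>z. green_infinity T z > 0 \<longleftrightarrow> z \<in> outside T" using pos unfolding H_def .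
qed

section \<open>One Gaussian step\<close>

lemma nn_integral_lborel_translate:
  fixes a :: "'a::euclidean_space"
  assumes [measurable]: "f \<in> borel_measurable borel"
  shows "(\<integral>\<^sup>+x. f (a + x) \<partial>lborel) = (\<integral>\<^sup>+x. f x \<partial>lborel)"
proof -
  have "(\<integral>\<^sup>+x. f x \<partial>lborel) = (\<integral>\<^sup>+x. f x \<partial>distr lborel borel ((+) a))"
    by (simp add: lborel_distr_plus)
  also have "\<dots> = (\<integral>\<^sup>+x. f (a + x) \<partial>lborel)"
    by (rule nn_integral_distr) auto
  finally show ?thesis ..
qed

text \<open>The standard proof that a translation invariant measure is unique up to a factor, which is
  determined here by the unit disc.\<close>

lemma nn_integral_lborel_rotate:
  fixes c :: complex
  assumes c: "norm c = 1" and [measurable]: "f \<in> borel_measurable borel"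
  shows "(\<integral>\<^sup>+x. f (c * x) \<partial>lborel) = (\<integral>\<^sup>+x. f x \<partial>lborel)"
proof -
  define g :: "complex \<Rightarrow> ennreal" where "g = indicator (ball 0 1)"
  have [measurable]: "g \<in> borel_measurable borel" unfolding g_def by (intro borel_measurable_indicator) simp
  have c0: "c \<noteq> 0" using c by auto
  have gc: "g (c * y) = g y" and gm: "g (- y) = g y" for y
    using c by (auto simp: g_def indicator_def norm_mult)
  define V where "V = (\<integral>\<^sup>+x. g x \<partial>lborel)"
  have "V = emeasure lborel (ball (0::complex) 1)" by (simp add: V_def g_def)
  then have V: "V \<noteq> 0" "V \<noteq> \<infinity>" by (auto simp: emeasure_ball eval_unit_ball_vol)
  have "(\<integral>\<^sup>+x. f x \<partial>lborel) * V = (\<integral>\<^sup>+y. (\<integral>\<^sup>+x. f x \<partial>lborel) * g (c * y) \<partial>lborel)"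
    by (simp add: gc V_def nn_integral_cmult)
  also have "\<dots> = (\<integral>\<^sup>+y. (\<integral>\<^sup>+x. f (c * y + x) * g (c * y) \<partial>lborel) \<partial>lborel)"
    by (simp add: nn_integral_multc nn_integral_lborel_translate)
  also have "\<dots> = (\<integral>\<^sup>+x. (\<integral>\<^sup>+y. f (c * y + x) * g (c * y) \<partial>lborel) \<partial>lborel)"
    by (rule lborel_pair.Fubini') simp
  \<comment> \<open>For fixed \<open>x\<close>, translating \<open>y\<close> by
    \<open>- (x / c)\<close> moves the shift from \<open>f\<close> to \<open>g\<close>.\<close>
  also have "\<dots> = (\<integral>\<^sup>+x. (\<integral>\<^sup>+y. f (c * y) * g (c * y - x) \<partial>lborel) \<partial>lborel)"
  proof (rule nn_integral_cong)
    fix x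
    show "(\<integral>\<^sup>+y. f (c * y + x) * g (c * y) \<partial>lborel) = (\<integral>\<^sup>+y. f (c * y) * g (c * y - x) \<partial>lborel)"
      using nn_integral_lborel_translate[of "\<lambda>y. f (c * y + x) * g (c * y)" "- (x / c)"] c0
      by (simp add: algebra_simps)
  qed
  also have "\<dots> = (\<integral>\<^sup>+y. (\<integral>\<^sup>+x. f (c * y) * g (c * y - x) \<partial>lborel) \<partial>lborel)"
    by (rule lborel_pair.Fubini') simp
  also have "\<dots> = (\<integral>\<^sup>+y. f (c * y) * V \<partial>lborel)"
  proof (rule nn_integral_cong)
    fix y
    have "(\<integral>\<^sup>+x. g (c * y - x) \<partial>lborel) = (\<integral>\<^sup>+x. g (- (c * y) + x) \<partial>lborel)"
      using gm[of "c * y - _"] by (simp add: algebra_simps)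
    also have "\<dots> = V" unfolding V_def by (rule nn_integral_lborel_translate) simp
    finally show "(\<integral>\<^sup>+x. f (c * y) * g (c * y - x) \<partial>lborel) = f (c * y) * V"
      by (simp add: nn_integral_cmult)
  qed
  also have "\<dots> = (\<integral>\<^sup>+y. f (c * y) \<partial>lborel) * V"
    by (rule nn_integral_multc) simp
  finally show ?thesis using V by (simp add: ennreal_mult_cancel_left mult.commute[of _ V])
qed

context green_function
begin

lemma measurable_H [measurable]: "H \<in> borel_measurable borel"
  using cont by (rule borel_measurable_continuous_onI)

lemma nn_integral_circle_mean:
  assumes "ball w r \<subseteq> {w. H w > 0}" "norm \<xi> < r"
  shows "(\<integral>\<^sup>+x. ennreal (H (w + \<xi> * exp (2 * of_real pi * \<i> * of_real x))) * indicator {0..1} x \<partial>lborel) = ennreal (H w)"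
  (is "(\<integral>\<^sup>+x. ennreal (?h x) * _ x \<partial>lborel) = _")
proof -
  have "(\<integral>\<^sup>+x. ennreal (?h x) * indicator {0..1} x \<partial>lborel) = (\<integral>\<^sup>+x. ennreal (indicator {0..1} x * ?h x) \<partial>lborel)"
    by (intro nn_integral_cong) (auto simp: indicator_def)
  also have "\<dots> = ennreal (H w)"
    by (rule nn_integral_has_integral_lebesgue[OF nonneg circle_mean[OF assms]])
  finally show ?thesis .
qed

text \<open>A radial weight is unchanged when the integrand is rotated by any angle. Averaging over
  all angles and exchanging the integrals puts a circle mean inside, so the mean value property
  applies without polar coordinates.\<close>

lemma nn_integral_ball_radial:
  fixes k :: "complex \<Rightarrow> ennreal"
  assumes [measurable]: "k \<in> borel_measurable borel"
    and radial: "\<And>c x. norm c = 1 \<Longrightarrow> k (c * x) = k x"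
    and sub: "ball w r \<subseteq> {w. H w > 0}"
  shows "(\<integral>\<^sup>+x. H (w + x) * (k x * indicator (ball 0 r) x) \<partial>lborel) =
    H w * (\<integral>\<^sup>+x. k x * indicator (ball 0 r) x \<partial>lborel)"
proof -
  let ?k = "\<lambda>x. k x * indicator (ball 0 r) x"
  let ?e = "\<lambda>\<theta>::real. exp (2 * of_real pi * \<i> * of_real \<theta>) :: complex"
  let ?I = "indicator {0..1} :: real \<Rightarrow> ennreal"
  have [measurable]: "ball (0::complex) r \<in> sets borel" by simp
  have ne: "norm (?e \<theta>) = 1" for \<theta> by simp
  have rot: "(\<integral>\<^sup>+x. H (w + x) * ?k x \<partial>lborel) = (\<integral>\<^sup>+x. H (w + x * ?e \<theta>) * ?k x \<partial>lborel)" for \<theta>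
    using nn_integral_lborel_rotate[OF ne[of \<theta>], of "\<lambda>x. H (w + x) * ?k x"] radial[OF ne[of \<theta>]]
    by (simp add: mult.commute indicator_def norm_mult)
  have "(\<integral>\<^sup>+x. H (w + x) * ?k x \<partial>lborel) = (\<integral>\<^sup>+\<theta>. (\<integral>\<^sup>+x. H (w + x) * ?k x \<partial>lborel) * ?I \<theta> \<partial>lborel)"
    by (simp add: nn_integral_cmult)
  also have "\<dots> = (\<integral>\<^sup>+\<theta>. (\<integral>\<^sup>+x. H (w + x * ?e \<theta>) * ?k x * ?I \<theta> \<partial>lborel) \<partial>lborel)"
  proof (rule nn_integral_cong)
    fix \<theta>
    show "(\<integral>\<^sup>+x. H (w + x) * ?k x \<partial>lborel) * ?I \<theta> = (\<integral>\<^sup>+x. H (w + x * ?e \<theta>) * ?k x * ?I \<theta> \<partial>lborel)"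
      unfolding rot[of \<theta>] by (rule nn_integral_multc[symmetric]) measurable
  qed
  also have "\<dots> = (\<integral>\<^sup>+x. (\<integral>\<^sup>+\<theta>. H (w + x * ?e \<theta>) * ?k x * ?I \<theta> \<partial>lborel) \<partial>lborel)"
    by (rule lborel_pair.Fubini') measurable
  also have "\<dots> = (\<integral>\<^sup>+x. H w * ?k x \<partial>lborel)"
  proof (rule nn_integral_cong)
    fix x
    have "(\<integral>\<^sup>+\<theta>. H (w + x * ?e \<theta>) * ?k x * ?I \<theta> \<partial>lborel) =
        ?k x * (\<integral>\<^sup>+\<theta>. H (w + x * ?e \<theta>) * ?I \<theta> \<partial>lborel)"
      by (subst nn_integral_cmult[symmetric]) (auto simp: mult_ac)
    also have "\<dots> = H w * ?k x"
      using nn_integral_circle_mean[OF sub, of x]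
      by (cases "norm x < r") (auto simp: mult.commute)
    finally show "(\<integral>\<^sup>+\<theta>. H (w + x * ?e \<theta>) * ?k x * ?I \<theta> \<partial>lborel) = H w * ?k x" .
  qed
  also have "\<dots> = H w * (\<integral>\<^sup>+x. ?k x \<partial>lborel)"
    by (rule nn_integral_cmult) simp
  finally show ?thesis .
qed

text \<open>The radius is uniform over the whole unbounded level set, because a compact set and a
  disjoint closed set have positive distance.\<close>

lemma level_set_ball:
  assumes "\<eta> > 0"
  obtains r where "r > 0" "\<And>w. H w \<ge> \<eta> \<Longrightarrow> ball w r \<subseteq> {w. H w > 0}"
proof -
  have "closed {w. H w \<ge> \<eta>}"
    using closed_Collect_le[OF continuous_on_const cont] by simp
  moreover have "{w. H w = 0} \<inter> {w. H w \<ge> \<eta>} = {}" using assms by auto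
  ultimately obtain d where d: "d > 0" "\<And>x y. H x = 0 \<Longrightarrow> H y \<ge> \<eta> \<Longrightarrow> d \<le> dist x y"
    using separate_compact_closed[OF compact_zero, of "{w. H w \<ge> \<eta>}"] by (metis mem_Collect_eq)
  have "H y > 0" if "H w \<ge> \<eta>" "y \<in> ball w d" for w y
    using d(2)[of y w] that nonneg[of y] by (auto simp: less_le dist_commute)
  then show ?thesis using d(1) that[of d] by blast
qed

end

section \<open>Tail and second moment of the heat kernel\<close>

lemma measurable_planar_heat_kernel [measurable]:
  "planar_heat_kernel t z \<in> borel_measurable borel"
  unfolding planar_heat_kernel_def by measurable

lemma planar_heat_kernel_nonneg: "t > 0 \<Longrightarrow> planar_heat_kernel t z w \<ge> 0"
  by (simp add: planar_heat_kernel_def)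

lemma planar_heat_kernel_rotate: "norm c = 1 \<Longrightarrow> planar_heat_kernel t 0 (c * w) = planar_heat_kernel t 0 w"
  by (simp add: planar_heat_kernel_def norm_mult)

text \<open>The exponential weight doubles the time of the kernel. Tail and moment bounds then
  follow from pointwise comparison with the exponential and total mass one at time
  \<open>2 * t\<close>, and no integral has to be computed.\<close>

lemma planar_heat_kernel_double:
  assumes "t > 0"
  shows "exp ((norm w)\<^sup>2 / (4 * t)) * planar_heat_kernel t 0 w = 2 * planar_heat_kernel (2 * t) 0 w"
proof -
  have "(norm w)\<^sup>2 / (4 * t) + - (norm w)\<^sup>2 / (2 * t) = - (norm w)\<^sup>2 / (2 * (2 * t))"
    using assms by (simp add: field_simps)
  then have "exp ((norm w)\<^sup>2 / (4 * t)) * exp (- (norm w)\<^sup>2 / (2 * t)) = exp (- (norm w)\<^sup>2 / (2 * (2 * t)))"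
    by (simp flip: exp_add)
  then show ?thesis
    using assms by (simp add: planar_heat_kernel_def field_simps)
qed

lemma planar_heat_kernel_tail:
  assumes t: "t > 0" and total: "(\<integral>\<^sup>+w. planar_heat_kernel (2 * t) 0 w \<partial>lborel) = 1" and r: "r \<ge> 0"
  shows "(\<integral>\<^sup>+w. ennreal (planar_heat_kernel t 0 w) * indicator (- ball 0 r) w \<partial>lborel) \<le> ennreal (2 * exp (- r\<^sup>2 / (4 * t)))"
proof -
  have "(\<integral>\<^sup>+w. ennreal (planar_heat_kernel t 0 w) * indicator (- ball 0 r) w \<partial>lborel) \<le>
      (\<integral>\<^sup>+w. ennreal (2 * exp (- r\<^sup>2 / (4 * t))) * planar_heat_kernel (2 * t) 0 w \<partial>lborel)"
  proof (rule nn_integral_mono)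
    fix w :: complex
    show "ennreal (planar_heat_kernel t 0 w) * indicator (- ball 0 r) w \<le>
        ennreal (2 * exp (- r\<^sup>2 / (4 * t))) * planar_heat_kernel (2 * t) 0 w"
    proof (cases "w \<in> ball 0 r")
      case False
      then have "r\<^sup>2 \<le> (norm w)\<^sup>2" using r by (simp add: power_mono)
      then have "r\<^sup>2 / (4 * t) \<le> (norm w)\<^sup>2 / (4 * t)"
        using t by (intro divide_right_mono) auto
      then have "1 \<le> exp (- r\<^sup>2 / (4 * t)) * exp ((norm w)\<^sup>2 / (4 * t))"
        by (simp flip: exp_add)
      then have "planar_heat_kernel t 0 w \<le>
          exp (- r\<^sup>2 / (4 * t)) * exp ((norm w)\<^sup>2 / (4 * t)) * planar_heat_kernel t 0 w"
        using mult_right_mono[OF _ planar_heat_kernel_nonneg[OF t, of 0 w]] by fastforce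
      also have "\<dots> = 2 * exp (- r\<^sup>2 / (4 * t)) * planar_heat_kernel (2 * t) 0 w"
        using planar_heat_kernel_double[OF t, of w] by (simp add: mult_ac)
      finally show ?thesis
        using False t by (simp add: ennreal_leI planar_heat_kernel_nonneg flip: ennreal_mult')
    qed simp
  qed
  also have "\<dots> = ennreal (2 * exp (- r\<^sup>2 / (4 * t)))"
    by (simp add: nn_integral_cmult total)
  finally show ?thesis .
qed

lemma planar_heat_kernel_second_moment:
  assumes t: "t > 0" and total: "(\<integral>\<^sup>+w. planar_heat_kernel (2 * t) 0 w \<partial>lborel) = 1"
  shows "(\<integral>\<^sup>+w. planar_heat_kernel t 0 w * ennreal ((norm w)\<^sup>2) \<partial>lborel) \<le> ennreal (8 * t)"
proof -
  have "(\<integral>\<^sup>+w. planar_heat_kernel t 0 w * ennreal ((norm w)\<^sup>2) \<partial>lborel) \<le>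
      (\<integral>\<^sup>+w. ennreal (8 * t) * planar_heat_kernel (2 * t) 0 w \<partial>lborel)"
  proof (rule nn_integral_mono)
    fix w :: complex
    have "(norm w)\<^sup>2 / (4 * t) \<le> exp ((norm w)\<^sup>2 / (4 * t))"
      using exp_ge_add_one_self[of "(norm w)\<^sup>2 / (4 * t)"] by linarith
    then have "(norm w)\<^sup>2 \<le> 4 * t * exp ((norm w)\<^sup>2 / (4 * t))"
      using t by (simp add: field_simps)
    from mult_right_mono[OF this planar_heat_kernel_nonneg[OF t, of 0 w]]
    have "planar_heat_kernel t 0 w * (norm w)\<^sup>2 \<le>
        4 * t * (exp ((norm w)\<^sup>2 / (4 * t)) * planar_heat_kernel t 0 w)"
      by (simp only: mult_ac)
    then have "planar_heat_kernel t 0 w * (norm w)\<^sup>2 \<le> 8 * t * planar_heat_kernel (2 * t) 0 w"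
      unfolding planar_heat_kernel_double[OF t, of w] by simp
    then show "planar_heat_kernel t 0 w * ennreal ((norm w)\<^sup>2) \<le> ennreal (8 * t) * planar_heat_kernel (2 * t) 0 w"
      using t by (simp add: ennreal_leI planar_heat_kernel_nonneg flip: ennreal_mult')
  qed
  also have "\<dots> = ennreal (8 * t)"
    by (simp add: nn_integral_cmult total)
  finally show ?thesis .
qed

lemma nn_integral_ball_split:
  fixes k :: "complex \<Rightarrow> ennreal"
  assumes [measurable]: "k \<in> borel_measurable borel"
  shows "(\<integral>\<^sup>+x. k x * indicator (ball 0 r) x \<partial>lborel) + (\<integral>\<^sup>+x. k x * indicator (- ball 0 r) x \<partial>lborel)
    = (\<integral>\<^sup>+x. k x \<partial>lborel)"
proof -
  have [measurable]: "ball (0::complex) r \<in> sets borel" by simp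
  have "(\<integral>\<^sup>+x. k x * indicator (ball 0 r) x \<partial>lborel) + (\<integral>\<^sup>+x. k x * indicator (- ball 0 r) x \<partial>lborel)
      = (\<integral>\<^sup>+x. k x * indicator (ball 0 r) x + k x * indicator (- ball 0 r) x \<partial>lborel)"
    by (rule nn_integral_add[symmetric]) measurable
  also have "\<dots> = (\<integral>\<^sup>+x. k x \<partial>lborel)"
    by (intro nn_integral_cong) (auto simp: indicator_def)
  finally show ?thesis .
qed

context green_function
begin

context
  fixes k :: "complex \<Rightarrow> ennreal" and w :: complex and r :: real
  assumes k [measurable]: "k \<in> borel_measurable borel"
    and radial: "\<And>c x. norm c = 1 \<Longrightarrow> k (c * x) = k x"
    and total: "(\<integral>\<^sup>+x. k x \<partial>lborel) = 1"
    and sub: "ball w r \<subseteq> {w. H w > 0}"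
begin

text \<open>On the disc the integral is at most \<open>H w\<close> by the mean value property and at
  most \<open>m\<close> trivially, hence at most their minimum. Off the disc the cap
  \<open>m\<close> keeps the contribution proportional to the tail mass, although \<open>H\<close>
  is unbounded.\<close>

lemma superharmonic_step:
  assumes "m \<ge> 0"
  shows "(\<integral>\<^sup>+x. ennreal (min (H (w + x)) m) * k x \<partial>lborel) \<le>
    ennreal (min (H w) m) + ennreal m * (\<integral>\<^sup>+x. k x * indicator (- ball 0 r) x \<partial>lborel)"
proof -
  have [measurable]: "ball (0::complex) r \<in> sets borel" by simp
  define P where "P = (\<integral>\<^sup>+x. k x * indicator (ball 0 r) x \<partial>lborel)"
  have "P \<le> P + (\<integral>\<^sup>+x. k x * indicator (- ball 0 r) x \<partial>lborel)" by simp
  then have P: "P \<le> 1" using nn_integral_ball_split[OF k, of r] total by (simp add: P_def)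
  let ?h = "\<lambda>x. ennreal (min (H (w + x)) m)"
  have "(\<integral>\<^sup>+x. ?h x * k x \<partial>lborel) =
      (\<integral>\<^sup>+x. ?h x * (k x * indicator (ball 0 r) x) + ?h x * (k x * indicator (- ball 0 r) x) \<partial>lborel)"
    by (intro nn_integral_cong) (auto simp: indicator_def)
  also have "\<dots> = (\<integral>\<^sup>+x. ?h x * (k x * indicator (ball 0 r) x) \<partial>lborel) +
      (\<integral>\<^sup>+x. ?h x * (k x * indicator (- ball 0 r) x) \<partial>lborel)"
    by (rule nn_integral_add) measurable
  also have "\<dots> \<le> ennreal (min (H w) m) + ennreal m * (\<integral>\<^sup>+x. k x * indicator (- ball 0 r) x \<partial>lborel)"
  proof (rule add_mono)
    have "(\<integral>\<^sup>+x. ?h x * (k x * indicator (ball 0 r) x) \<partial>lborel) \<le> (\<integral>\<^sup>+x. H (w + x) * (k x * indicator (ball 0 r) x) \<partial>lborel)"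
      by (intro nn_integral_mono mult_right_mono ennreal_leI) auto
    also have "\<dots> = H w * P"
      unfolding P_def by (rule nn_integral_ball_radial[OF k radial sub])
    also have "\<dots> \<le> H w" using mult_left_mono[OF P, of "ennreal (H w)"] by simp
    finally have 1: "(\<integral>\<^sup>+x. ?h x * (k x * indicator (ball 0 r) x) \<partial>lborel) \<le> H w" .
    have "(\<integral>\<^sup>+x. ?h x * (k x * indicator (ball 0 r) x) \<partial>lborel) \<le> (\<integral>\<^sup>+x. ennreal m * (k x * indicator (ball 0 r) x) \<partial>lborel)"
      by (intro nn_integral_mono mult_right_mono ennreal_leI) auto
    also have "\<dots> = m * P"
      unfolding P_def by (rule nn_integral_cmult) measurable
    also have "\<dots> \<le> m" using mult_left_mono[OF P, of "ennreal m"] by simp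
    finally have 2: "(\<integral>\<^sup>+x. ?h x * (k x * indicator (ball 0 r) x) \<partial>lborel) \<le> m" .
    show "(\<integral>\<^sup>+x. ?h x * (k x * indicator (ball 0 r) x) \<partial>lborel) \<le> ennreal (min (H w) m)"
      using 1 2 by (simp add: min_def)
    have "(\<integral>\<^sup>+x. ?h x * (k x * indicator (- ball 0 r) x) \<partial>lborel) \<le> (\<integral>\<^sup>+x. ennreal m * (k x * indicator (- ball 0 r) x) \<partial>lborel)"
      by (intro nn_integral_mono mult_right_mono ennreal_leI) auto
    also have "\<dots> = m * (\<integral>\<^sup>+x. k x * indicator (- ball 0 r) x \<partial>lborel)"
      by (rule nn_integral_cmult) measurable
    finally show "(\<integral>\<^sup>+x. ?h x * (k x * indicator (- ball 0 r) x) \<partial>lborel) \<le> m * (\<integral>\<^sup>+x. k x * indicator (- ball 0 r) x \<partial>lborel)" .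
  qed
  finally show ?thesis .
qed

text \<open>Integrating \<open>H \<le> \<eta> + max (H - \<eta>) 0\<close> over the disc and
  cancelling the share of \<open>\<eta>\<close> leaves the claim. What happens off the disc is
  nonnegative and may be dropped.\<close>

lemma subharmonic_step:
  assumes "\<eta> \<ge> 0"
  shows "ennreal (max (H w - \<eta>) 0) * (\<integral>\<^sup>+x. k x * indicator (ball 0 r) x \<partial>lborel) \<le>
    (\<integral>\<^sup>+x. ennreal (max (H (w + x) - \<eta>) 0) * k x \<partial>lborel)"
proof (cases "H w \<ge> \<eta>")
  case True
  have [measurable]: "ball (0::complex) r \<in> sets borel" by simp
  let ?k = "\<lambda>x. k x * indicator (ball 0 r) x" and ?v = "\<lambda>x. ennreal (max (H (w + x) - \<eta>) 0)"
  define P where "P = (\<integral>\<^sup>+x. ?k x \<partial>lborel)"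
  have "P \<le> P + (\<integral>\<^sup>+x. k x * indicator (- ball 0 r) x \<partial>lborel)" by simp
  then have P: "P \<le> 1" using nn_integral_ball_split[OF k, of r] total by (simp add: P_def)
  have "ennreal \<eta> * P + ennreal (H w - \<eta>) * P = ennreal (H w) * P"
    using True assms by (simp flip: distrib_right ennreal_plus)
  also have "\<dots> = (\<integral>\<^sup>+x. H (w + x) * ?k x \<partial>lborel)"
    unfolding P_def by (rule nn_integral_ball_radial[OF k radial sub, symmetric])
  also have "\<dots> \<le> (\<integral>\<^sup>+x. ennreal \<eta> * ?k x + ?v x * ?k x \<partial>lborel)"
  proof (rule nn_integral_mono)
    fix x
    have "ennreal (H (w + x)) \<le> ennreal \<eta> + ?v x"
      using assms by (subst ennreal_plus[symmetric]) (auto simp del: ennreal_plus intro!: ennreal_leI)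
    from mult_right_mono[OF this, of "?k x"]
    show "ennreal (H (w + x)) * ?k x \<le> ennreal \<eta> * ?k x + ?v x * ?k x"
      by (simp add: distrib_right)
  qed
  also have "\<dots> = ennreal \<eta> * P + (\<integral>\<^sup>+x. ?v x * ?k x \<partial>lborel)"
    unfolding P_def by (simp add: nn_integral_add nn_integral_cmult)
  finally have le: "ennreal \<eta> * P + ennreal (H w - \<eta>) * P \<le> ennreal \<eta> * P + (\<integral>\<^sup>+x. ?v x * ?k x \<partial>lborel)" .
  \<comment> \<open>Cancellation in \<open>ennreal\<close> requires the common summand to be
    finite.\<close>
  have "P < \<top>" using P by (simp add: order_le_less_trans[OF _ ennreal_one_less_top])
  then have "ennreal \<eta> * P \<noteq> \<top>"
    by (simp add: ennreal_mult_eq_top_iff)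
  then have "ennreal (H w - \<eta>) * P \<le> (\<integral>\<^sup>+x. ?v x * ?k x \<partial>lborel)"
    using le by (simp add: ennreal_add_left_cancel_le)
  also have "\<dots> \<le> (\<integral>\<^sup>+x. ?v x * k x \<partial>lborel)"
    by (intro nn_integral_mono mult_left_mono) (auto simp: indicator_def)
  finally show ?thesis using True by (simp add: P_def max_def)
qed simp

end
end

section \<open>Survival of Brownian motion\<close>

text \<open>By independence the second variable may be resampled with the first one frozen; this is
  the source of the Markov property at grid times.\<close>

lemma (in prob_space) nn_integral_indep_var:
  assumes indep: "indep_var S Y T Z"
    and [measurable]: "\<Psi> \<in> borel_measurable (S \<Otimes>\<^sub>M T)"
  shows "(\<integral>\<^sup>+\<omega>. \<Psi> (Y \<omega>, Z \<omega>) \<partial>M) = (\<integral>\<^sup>+\<omega>. (\<integral>\<^sup>+\<omega>'. \<Psi> (Y \<omega>, Z \<omega>') \<partial>M) \<partial>M)"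
proof -
  have [measurable]: "random_variable S Y" "random_variable T Z"
    and eq: "distr M S Y \<Otimes>\<^sub>M distr M T Z = distr M (S \<Otimes>\<^sub>M T) (\<lambda>\<omega>. (Y \<omega>, Z \<omega>))"
    using indep unfolding indep_var_distribution_eq by auto
  interpret Z: prob_space "distr M T Z" by (rule prob_space_distr) simp
  have [measurable]: "\<Psi> \<in> borel_measurable (S \<Otimes>\<^sub>M distr M T Z)"
    "\<Psi> \<in> borel_measurable (distr M S Y \<Otimes>\<^sub>M distr M T Z)"
    by (simp_all cong: measurable_cong_sets sets_pair_measure_cong)
  have "(\<integral>\<^sup>+\<omega>. \<Psi> (Y \<omega>, Z \<omega>) \<partial>M) = (\<integral>\<^sup>+p. \<Psi> p \<partial>distr M (S \<Otimes>\<^sub>M T) (\<lambda>\<omega>. (Y \<omega>, Z \<omega>)))"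
    by (rule nn_integral_distr[symmetric]) measurable
  also have "\<dots> = (\<integral>\<^sup>+p. \<Psi> p \<partial>(distr M S Y \<Otimes>\<^sub>M distr M T Z))"
    unfolding eq ..
  also have "\<dots> = (\<integral>\<^sup>+y. (\<integral>\<^sup>+x. \<Psi> (y, x) \<partial>distr M T Z) \<partial>distr M S Y)"
    by (rule Z.nn_integral_fst[symmetric]) measurable
  also have "\<dots> = (\<integral>\<^sup>+\<omega>. (\<integral>\<^sup>+x. \<Psi> (Y \<omega>, x) \<partial>distr M T Z) \<partial>M)"
    by (rule nn_integral_distr) measurable
  also have "\<dots> = (\<integral>\<^sup>+\<omega>. (\<integral>\<^sup>+\<omega>'. \<Psi> (Y \<omega>, Z \<omega>') \<partial>M) \<partial>M)"
  proof (rule nn_integral_cong)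
    fix \<omega> assume "\<omega> \<in> space M"
    then have [measurable]: "(\<lambda>x. \<Psi> (Y \<omega>, x)) \<in> borel_measurable T"
      by measurable
    show "(\<integral>\<^sup>+x. \<Psi> (Y \<omega>, x) \<partial>distr M T Z) = (\<integral>\<^sup>+\<omega>'. \<Psi> (Y \<omega>, Z \<omega>') \<partial>M)"
      by (rule nn_integral_distr) measurable
  qed
  finally show ?thesis .
qed

locale planar_brownian =
  fixes M :: "'a measure" and B :: "real \<Rightarrow> 'a \<Rightarrow> complex" and z :: complex
  assumes planar_brownian_motion: "planar_brownian_motion M B z"

sublocale planar_brownian \<subseteq> prob_space M
  using planar_brownian_motion by (simp add: planar_brownian_motion_def)

context planar_brownian
begin

lemma measurable_B [measurable]: "t \<ge> 0 \<Longrightarrow> B t \<in> borel_measurable M"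
  and B_0: "\<omega> \<in> space M \<Longrightarrow> B 0 \<omega> = z"
  and continuous_paths: "\<omega> \<in> space M \<Longrightarrow> continuous_on {0..} (\<lambda>t. B t \<omega>)"
  and distributed_increment: "0 \<le> s \<Longrightarrow> s < t \<Longrightarrow>
        distributed M lborel (\<lambda>\<omega>. B t \<omega> - B s \<omega>) (\<lambda>w. ennreal (planar_heat_kernel (t - s) 0 w))"
  using planar_brownian_motion unfolding planar_brownian_motion_def by auto

lemma indep_increments:
  "0 \<le> \<sigma> 0 \<Longrightarrow> incseq \<sigma> \<Longrightarrow>
    indep_vars (\<lambda>_. borel) (\<lambda>i \<omega>. B (\<sigma> (Suc i)) \<omega> - B (\<sigma> i) \<omega>) (UNIV :: nat set)"
  using planar_brownian_motion unfolding planar_brownian_motion_def by blast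

lemma distributed_from_start:
  assumes "t > 0"
  shows "distributed M lborel (\<lambda>\<omega>. B t \<omega> - B 0 \<omega>) (\<lambda>w. ennreal (planar_heat_kernel t 0 w))"
  using distributed_increment[of 0 t] assms by simp

text \<open>The Gaussian integral comes for free: the kernel is the density of an increment on a
  probability space.\<close>

lemma nn_integral_heat_kernel:
  assumes "t > 0"
  shows "(\<integral>\<^sup>+w. planar_heat_kernel t 0 w \<partial>lborel) = 1"
  using distributed_emeasure[OF distributed_from_start[OF assms], of UNIV] emeasure_space_1 by simp

text \<open>The positions up to index \<open>k\<close> are partial sums of the first
  \<open>k\<close> increments, and the next increment is independent of these with the Gaussian law.
  Integrating it out gives one step of the walk killed on leaving \<open>G\<close>.\<close>

lemma grid_Markov_property:
  fixes f :: "complex \<Rightarrow> ennreal"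
  assumes d: "d > 0" and [measurable]: "f \<in> borel_measurable borel" "G \<in> sets borel"
  defines "X \<equiv> \<lambda>j \<omega>. B (real j * d) \<omega>"
  shows "(\<integral>\<^sup>+\<omega>. f (X (Suc k) \<omega>) * indicator {\<omega>. \<forall>j\<le>Suc k. X j \<omega> \<in> G} \<omega> \<partial>M) =
    (\<integral>\<^sup>+\<omega>. (\<integral>\<^sup>+x. f (X k \<omega> + x) * indicator G (X k \<omega> + x) * planar_heat_kernel d 0 x \<partial>lborel)
         * indicator {\<omega>. \<forall>j\<le>k. X j \<omega> \<in> G} \<omega> \<partial>M)"
proof -
  define \<xi> where "\<xi> = (\<lambda>i \<omega>. B (real (Suc i) * d) \<omega> - B (real i * d) \<omega>)"
  define Y where "Y = (\<lambda>\<omega>. restrict (\<lambda>i. \<xi> i \<omega>) {..<k})"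
  define P where "P = PiM {..<k} (\<lambda>_. borel :: complex measure)"
  define S where "S = (\<lambda>j (y :: nat \<Rightarrow> complex). z + (\<Sum>i<j. y i))"
  have "indep_vars (\<lambda>_. borel) \<xi> UNIV"
    unfolding \<xi>_def using d by (intro indep_increments) (auto intro!: incseq_SucI simp: algebra_simps)
  \<comment> \<open>Independence is available between disjoint groups of increments, so the single
    increment \<open>\<xi> k\<close> enters as a family indexed by \<open>{k}\<close>.\<close>
  then have indep: "indep_var P Y (PiM {k} (\<lambda>_. borel)) (\<lambda>\<omega>. restrict (\<lambda>i. \<xi> i \<omega>) {k})"
    unfolding P_def Y_def by (rule indep_var_restrict) auto
  have dist: "distributed M lborel (\<xi> k) (\<lambda>w. ennreal (planar_heat_kernel d 0 w))"
    using distributed_increment[of "real k * d" "real (Suc k) * d"] d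
    by (simp add: \<xi>_def algebra_simps)
  have SY: "S j (Y \<omega>) = X j \<omega>" if "j \<le> k" "\<omega> \<in> space M" for j \<omega>
  proof -
    have "(\<Sum>i<j. Y \<omega> i) = (\<Sum>i<j. B (real (Suc i) * d) \<omega> - B (real i * d) \<omega>)"
      using that(1) by (intro sum.cong) (auto simp: Y_def \<xi>_def)
    also have "\<dots> = B (real j * d) \<omega> - B 0 \<omega>"
      by (subst sum_lessThan_telescope) simp
    finally show ?thesis using B_0[OF that(2)] by (simp add: S_def X_def)
  qed
  have [measurable]: "S j \<in> borel_measurable P" if "j \<le> k" for j
    unfolding S_def P_def using that
    by (intro borel_measurable_add borel_measurable_sum borel_measurable_const measurable_component_singleton) auto
  \<comment> \<open>The integrand as a function of the past \<open>y\<close> and the next increment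
    \<open>x\<close>; the condition at index \<open>Suc k\<close> is split off, being the only one
    that involves \<open>x\<close>.\<close>
  define \<Psi> where "\<Psi> = (\<lambda>(y, x). f (S k y + x) * indicator G (S k y + x) *
      indicator {y \<in> space P. \<forall>j\<in>{..k}. S j y \<in> G} y :: ennreal)"
  have [measurable]: "{y \<in> space P. \<forall>j\<in>{..k}. S j y \<in> G} \<in> sets P"
    by (rule sets.sets_Collect_finite_All') (auto intro: measurable_sets_Collect)
  have [measurable]: "\<Psi> \<in> borel_measurable (P \<Otimes>\<^sub>M borel)"
    unfolding \<Psi>_def by measurable
  have [measurable]: "(\<lambda>y. y k) \<in> borel_measurable (PiM {k} (\<lambda>_. borel :: complex measure))"
    by (rule measurable_component_singleton) simp
  have \<Psi>: "(\<lambda>(y, x). \<Psi> (y, x k)) \<in> borel_measurable (P \<Otimes>\<^sub>M PiM {k} (\<lambda>_. borel))"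
    by measurable
  have YP: "Y \<omega> \<in> space P" for \<omega> by (auto simp: Y_def P_def space_PiM)
  have ind: "indicator {y \<in> space P. \<forall>j\<in>{..k}. S j y \<in> G} (Y \<omega>) = (indicator {\<omega>. \<forall>j\<le>k. X j \<omega> \<in> G} \<omega> :: ennreal)"
    if "\<omega> \<in> space M" for \<omega>
    using YP SY[OF _ that] by (auto simp: indicator_def)
  have Xnext: "X k \<omega> + \<xi> k \<omega> = X (Suc k) \<omega>" for \<omega> by (simp add: X_def \<xi>_def)
  have "(\<integral>\<^sup>+\<omega>. f (X (Suc k) \<omega>) * indicator {\<omega>. \<forall>j\<le>Suc k. X j \<omega> \<in> G} \<omega> \<partial>M) = (\<integral>\<^sup>+\<omega>. \<Psi> (Y \<omega>, \<xi> k \<omega>) \<partial>M)"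
  proof (rule nn_integral_cong)
    fix \<omega> assume "\<omega> \<in> space M"
    then show "f (X (Suc k) \<omega>) * indicator {\<omega>. \<forall>j\<le>Suc k. X j \<omega> \<in> G} \<omega> = \<Psi> (Y \<omega>, \<xi> k \<omega>)"
      using ind SY[of k \<omega>] Xnext[of \<omega>] by (auto simp: \<Psi>_def indicator_def le_Suc_eq)
  qed
  also have "\<dots> = (\<integral>\<^sup>+\<omega>. (\<integral>\<^sup>+\<omega>'. \<Psi> (Y \<omega>, \<xi> k \<omega>') \<partial>M) \<partial>M)"
    using nn_integral_indep_var[OF indep \<Psi>] by simp
  also have "\<dots> = (\<integral>\<^sup>+\<omega>. (\<integral>\<^sup>+x. \<Psi> (Y \<omega>, x) * planar_heat_kernel d 0 x \<partial>lborel) \<partial>M)"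
  proof (rule nn_integral_cong)
    fix \<omega>
    have [measurable]: "(\<lambda>x. \<Psi> (Y \<omega>, x)) \<in> borel_measurable borel"
      using YP by measurable
    show "(\<integral>\<^sup>+\<omega>'. \<Psi> (Y \<omega>, \<xi> k \<omega>') \<partial>M) = (\<integral>\<^sup>+x. \<Psi> (Y \<omega>, x) * planar_heat_kernel d 0 x \<partial>lborel)"
      by (subst distributed_nn_integral[OF dist, symmetric]) (simp_all add: mult.commute)
  qed
  also have "\<dots> = (\<integral>\<^sup>+\<omega>. (\<integral>\<^sup>+x. f (X k \<omega> + x) * indicator G (X k \<omega> + x) * planar_heat_kernel d 0 x \<partial>lborel)
         * indicator {\<omega>. \<forall>j\<le>k. X j \<omega> \<in> G} \<omega> \<partial>M)"
  proof (rule nn_integral_cong)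
    fix \<omega> assume \<omega>: "\<omega> \<in> space M"
    show "(\<integral>\<^sup>+x. \<Psi> (Y \<omega>, x) * planar_heat_kernel d 0 x \<partial>lborel) =
       (\<integral>\<^sup>+x. f (X k \<omega> + x) * indicator G (X k \<omega> + x) * planar_heat_kernel d 0 x \<partial>lborel)
         * indicator {\<omega>. \<forall>j\<le>k. X j \<omega> \<in> G} \<omega>"
      using SY[of k \<omega>] ind[OF \<omega>] \<omega>
      by (subst nn_integral_multc[symmetric]) (auto simp: \<Psi>_def mult_ac)
  qed
  finally show ?thesis .
qed

end

text \<open>By continuity the strict inequality persists near \<open>s\<close>, and a sufficiently
  fine grid has a point there.\<close>

lemma grid_approx:
  fixes p :: "real \<Rightarrow> real"
  assumes t: "t > 0" and cont: "continuous_on {0..t} p" and s: "s \<in> {0..t}" "p s < \<eta>"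
  shows "\<forall>\<^sub>F n in sequentially. \<exists>j\<le>Suc n. p (real j * (t / real (Suc n))) < \<eta>"
proof -
  obtain d where d: "d > 0" "\<And>s'. s' \<in> {0..t} \<Longrightarrow> dist s' s < d \<Longrightarrow> dist (p s') (p s) < \<eta> - p s"
    using cont s unfolding continuous_on_iff by (metis diff_gt_0_iff_gt)
  have "(\<lambda>n. t / real (Suc n)) \<longlonglongrightarrow> 0"
    by (rule LIMSEQ_Suc) (rule lim_const_over_n)
  then have "\<forall>\<^sub>F n in sequentially. t / real (Suc n) < d"
    using d(1) by (rule order_tendstoD(2))
  then show ?thesis
  proof eventually_elim
    case (elim n)
    define e where "e = t / real (Suc n)"
    have e: "e > 0" "e < d" "real (Suc n) * e = t" using t elim by (auto simp: e_def)
    \<comment> \<open>The last grid index whose time does not exceed \<open>s\<close>.\<close>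
    define j where "j = nat \<lfloor>s / e\<rfloor>"
    have "0 \<le> s / e" using s e by simp
    then have j: "real j \<le> s / e" "s / e < real j + 1" unfolding j_def by linarith+
    then have js: "real j * e \<le> s" "s < real j * e + e" using e(1) by (auto simp: field_simps)
    have "real j * e \<le> real (Suc n) * e" using js(1) s e(3) by simp
    then have "j \<le> Suc n" using e(1) by (metis mult_le_cancel_right_pos of_nat_le_iff)
    moreover have "dist (p (real j * e)) (p s) < \<eta> - p s"
      using js e s by (intro d(2)) (auto simp: dist_real_def)
    then have "p (real j * e) < \<eta>" by (simp add: dist_real_def)
    ultimately show ?case unfolding e_def by blast
  qed
qed

lemma gaussian_tail_sum_tendsto:
  fixes t r :: real
  assumes "t > 0" "r > 0"
  shows "(\<lambda>n. real (Suc n) * (2 * exp (- r\<^sup>2 / (4 * (t / real (Suc n)))))) \<longlonglongrightarrow> 0"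
proof -
  define a where "a = r\<^sup>2 / (4 * t)"
  have "a > 0" using assms by (simp add: a_def)
  then have "(\<lambda>n. real n * (2 * exp (- a * real n))) \<longlonglongrightarrow> 0" by real_asymp
  then have "(\<lambda>n. real (Suc n) * (2 * exp (- a * real (Suc n)))) \<longlonglongrightarrow> 0" by (rule LIMSEQ_Suc)
  then show ?thesis by (simp add: a_def)
qed

locale brownian_green = planar_brownian M B z + green_function H C R\<^sub>0
  for M :: "'a measure" and B z H C R\<^sub>0
begin

text \<open>Deliberately not intersected with \<open>space M\<close>, so as to match the indicators
  in \<open>grid_Markov_property\<close>; measurability is therefore stated for the trace on
  \<open>space M\<close> and for the indicator.\<close>

definition stay :: "real \<Rightarrow> real \<Rightarrow> nat \<Rightarrow> 'a set" where
  "stay \<eta> d k = {\<omega>. \<forall>j\<le>k. H (B (real j * d) \<omega>) \<ge> \<eta>}"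

lemma measurable_stay:
  assumes d: "d > 0"
  shows "{\<omega> \<in> space M. \<omega> \<in> stay \<eta> d k} \<in> sets M"
proof -
  have "{\<omega> \<in> space M. \<eta> \<le> H (B (real j * d) \<omega>)} \<in> sets M" for j
  proof -
    have [measurable]: "B (real j * d) \<in> borel_measurable M" using d by simp
    show ?thesis by measurable
  qed
  then have "{\<omega> \<in> space M. \<forall>j\<in>{..k}. \<eta> \<le> H (B (real j * d) \<omega>)} \<in> sets M"
    by (intro sets.sets_Collect_finite_All') auto
  moreover have "{\<omega> \<in> space M. \<omega> \<in> stay \<eta> d k} = {\<omega> \<in> space M. \<forall>j\<in>{..k}. \<eta> \<le> H (B (real j * d) \<omega>)}"
    unfolding stay_def by blast
  ultimately show ?thesis by (simp only:)
qed

lemma measurable_stay_indicator: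
  assumes d: "d > 0"
  shows "(indicator (stay \<eta> d k) :: 'a \<Rightarrow> ennreal) \<in> borel_measurable M"
proof -
  have "(indicator {\<omega> \<in> space M. \<omega> \<in> stay \<eta> d k} :: 'a \<Rightarrow> ennreal) \<in> borel_measurable M"
    using measurable_stay[OF d] by (rule borel_measurable_indicator)
  then show ?thesis by (rule measurable_cong[THEN iffD1, rotated]) (simp add: indicator_def)
qed

context
  fixes \<eta> r d :: real
  assumes \<eta>: "\<eta> > 0" and d: "d > 0"
    and ball: "\<And>w. H w \<ge> \<eta> \<Longrightarrow> ball w r \<subseteq> {w. H w > 0}"
begin

lemmas [measurable] = measurable_stay_indicator[OF d]

lemma stay_step:
  assumes [measurable]: "f \<in> borel_measurable borel"
  shows "(\<integral>\<^sup>+\<omega>. f (B (real (Suc k) * d) \<omega>) * indicator (stay \<eta> d (Suc k)) \<omega> \<partial>M) =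
    (\<integral>\<^sup>+\<omega>. (\<integral>\<^sup>+x. f (B (real k * d) \<omega> + x) * indicator {w. H w \<ge> \<eta>} (B (real k * d) \<omega> + x)
        * planar_heat_kernel d 0 x \<partial>lborel) * indicator (stay \<eta> d k) \<omega> \<partial>M)"
proof -
  have "{w. H w \<ge> \<eta>} \<in> sets borel" by measurable
  from grid_Markov_property[OF d assms this, of k] show ?thesis by (simp add: stay_def)
qed

text \<open>Killing only lowers the integral, so it may be ignored in the induction step, where
  \<open>superharmonic_step\<close> adds one error of size \<open>m\<close> times the tail
  mass.\<close>

lemma stay_upper:
  assumes m: "m \<ge> 0"
  shows "(\<integral>\<^sup>+\<omega>. ennreal (min (H (B (real k * d) \<omega>)) m) * indicator (stay \<eta> d k) \<omega> \<partial>M) \<le>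
    ennreal (min (H z) m) + of_nat k *
      (ennreal m * (\<integral>\<^sup>+x. ennreal (planar_heat_kernel d 0 x) * indicator (- ball 0 r) x \<partial>lborel))"
proof (induction k)
  case 0
  have "(\<integral>\<^sup>+\<omega>. ennreal (min (H (B (real 0 * d) \<omega>)) m) * indicator (stay \<eta> d 0) \<omega> \<partial>M)
      \<le> (\<integral>\<^sup>+\<omega>. ennreal (min (H z) m) \<partial>M)"
    by (intro nn_integral_mono) (auto simp: B_0 indicator_def)
  then show ?case by (simp add: emeasure_space_1)
next
  case (Suc k)
  let ?q = "\<integral>\<^sup>+x. ennreal (planar_heat_kernel d 0 x) * indicator (- ball 0 r) x \<partial>lborel"
  have Bk [measurable]: "B (real k * d) \<in> borel_measurable M" using d by simp
  have "(\<integral>\<^sup>+\<omega>. ennreal (min (H (B (real (Suc k) * d) \<omega>)) m) * indicator (stay \<eta> d (Suc k)) \<omega> \<partial>M)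
    = (\<integral>\<^sup>+\<omega>. (\<integral>\<^sup>+x. ennreal (min (H (B (real k * d) \<omega> + x)) m) * indicator {w. H w \<ge> \<eta>} (B (real k * d) \<omega> + x)
        * planar_heat_kernel d 0 x \<partial>lborel) * indicator (stay \<eta> d k) \<omega> \<partial>M)"
    by (rule stay_step) measurable
  also have "\<dots> \<le> (\<integral>\<^sup>+\<omega>. ennreal (min (H (B (real k * d) \<omega>)) m) * indicator (stay \<eta> d k) \<omega> + ennreal m * ?q \<partial>M)"
  proof (rule nn_integral_mono)
    fix \<omega>
    let ?w = "B (real k * d) \<omega>"
    show "(\<integral>\<^sup>+x. ennreal (min (H (?w + x)) m) * indicator {w. H w \<ge> \<eta>} (?w + x)
        * planar_heat_kernel d 0 x \<partial>lborel) * indicator (stay \<eta> d k) \<omega> \<le>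
      ennreal (min (H ?w) m) * indicator (stay \<eta> d k) \<omega> + ennreal m * ?q"
    proof (cases "\<omega> \<in> stay \<eta> d k")
      case True
      then have "ball ?w r \<subseteq> {w. H w > 0}" by (intro ball) (simp add: stay_def)
      then have "(\<integral>\<^sup>+x. ennreal (min (H (?w + x)) m) * planar_heat_kernel d 0 x \<partial>lborel) \<le> ennreal (min (H ?w) m) + ennreal m * ?q"
        using d m by (intro superharmonic_step nn_integral_heat_kernel) (auto simp: planar_heat_kernel_rotate)
      moreover have "(\<integral>\<^sup>+x. ennreal (min (H (?w + x)) m) * indicator {w. H w \<ge> \<eta>} (?w + x) * planar_heat_kernel d 0 x \<partial>lborel)
          \<le> (\<integral>\<^sup>+x. ennreal (min (H (?w + x)) m) * planar_heat_kernel d 0 x \<partial>lborel)"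
        by (intro nn_integral_mono) (auto simp: indicator_def)
      ultimately show ?thesis using True by simp
    qed simp
  qed
  also have "\<dots> = (\<integral>\<^sup>+\<omega>. ennreal (min (H (B (real k * d) \<omega>)) m) * indicator (stay \<eta> d k) \<omega> \<partial>M) + ennreal m * ?q"
    by (subst nn_integral_add) (auto simp: emeasure_space_1)
  also have "\<dots> \<le> ennreal (min (H z) m) + of_nat k * (ennreal m * ?q) + ennreal m * ?q"
    by (rule add_right_mono) (rule Suc.IH)
  also have "\<dots> = ennreal (min (H z) m) + of_nat (Suc k) * (ennreal m * ?q)"
    by (simp add: algebra_simps)
  finally show ?case .
qed

text \<open>The truncated function vanishes wherever the walk is killed, so killing costs nothing.
  Each step loses only a factor, the mass of the disc.\<close>

lemma stay_lower:
  "ennreal (max (H z - \<eta>) 0) * (\<integral>\<^sup>+x. ennreal (planar_heat_kernel d 0 x) * indicator (ball 0 r) x \<partial>lborel) ^ k \<le>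
    (\<integral>\<^sup>+\<omega>. ennreal (max (H (B (real k * d) \<omega>) - \<eta>) 0) * indicator (stay \<eta> d k) \<omega> \<partial>M)"
proof (induction k)
  case 0
  have "(\<integral>\<^sup>+\<omega>. ennreal (max (H z - \<eta>) 0) \<partial>M) \<le>
      (\<integral>\<^sup>+\<omega>. ennreal (max (H (B (real 0 * d) \<omega>) - \<eta>) 0) * indicator (stay \<eta> d 0) \<omega> \<partial>M)"
    by (intro nn_integral_mono) (auto simp: B_0 indicator_def stay_def max_def intro!: ennreal_neg)
  then show ?case by (simp add: emeasure_space_1)
next
  case (Suc k)
  let ?q = "\<integral>\<^sup>+x. ennreal (planar_heat_kernel d 0 x) * indicator (ball 0 r) x \<partial>lborel"
  have Bk [measurable]: "B (real k * d) \<in> borel_measurable M" using d by simp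
  have "ennreal (max (H z - \<eta>) 0) * ?q ^ Suc k = ?q * (ennreal (max (H z - \<eta>) 0) * ?q ^ k)"
    by (simp add: mult_ac)
  also have "\<dots> \<le> ?q * (\<integral>\<^sup>+\<omega>. ennreal (max (H (B (real k * d) \<omega>) - \<eta>) 0) * indicator (stay \<eta> d k) \<omega> \<partial>M)"
    by (rule mult_left_mono[OF Suc.IH]) simp
  also have "\<dots> = (\<integral>\<^sup>+\<omega>. ?q * (ennreal (max (H (B (real k * d) \<omega>) - \<eta>) 0) * indicator (stay \<eta> d k) \<omega>) \<partial>M)"
    by (rule nn_integral_cmult[symmetric]) measurable
  also have "\<dots> \<le> (\<integral>\<^sup>+\<omega>. (\<integral>\<^sup>+x. ennreal (max (H (B (real k * d) \<omega> + x) - \<eta>) 0) * indicator {w. H w \<ge> \<eta>} (B (real k * d) \<omega> + x)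
        * planar_heat_kernel d 0 x \<partial>lborel) * indicator (stay \<eta> d k) \<omega> \<partial>M)"
  proof (rule nn_integral_mono)
    fix \<omega>
    let ?w = "B (real k * d) \<omega>"
    show "?q * (ennreal (max (H ?w - \<eta>) 0) * indicator (stay \<eta> d k) \<omega>) \<le>
      (\<integral>\<^sup>+x. ennreal (max (H (?w + x) - \<eta>) 0) * indicator {w. H w \<ge> \<eta>} (?w + x)
        * planar_heat_kernel d 0 x \<partial>lborel) * indicator (stay \<eta> d k) \<omega>"
    proof (cases "\<omega> \<in> stay \<eta> d k")
      case True
      then have "ball ?w r \<subseteq> {w. H w > 0}" by (intro ball) (simp add: stay_def)
      then have "ennreal (max (H ?w - \<eta>) 0) * ?q \<le> (\<integral>\<^sup>+x. ennreal (max (H (?w + x) - \<eta>) 0) * planar_heat_kernel d 0 x \<partial>lborel)"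
        using d \<eta> by (intro subharmonic_step nn_integral_heat_kernel) (auto simp: planar_heat_kernel_rotate)
      also have "\<dots> = (\<integral>\<^sup>+x. ennreal (max (H (?w + x) - \<eta>) 0) * indicator {w. H w \<ge> \<eta>} (?w + x) * planar_heat_kernel d 0 x \<partial>lborel)"
        by (intro nn_integral_cong) (auto simp: indicator_def max_def intro!: ennreal_neg)
      finally show ?thesis using True by (simp add: mult.commute)
    qed simp
  qed
  also have "\<dots> = (\<integral>\<^sup>+\<omega>. ennreal (max (H (B (real (Suc k) * d) \<omega>) - \<eta>) 0) * indicator (stay \<eta> d (Suc k)) \<omega> \<partial>M)"
    by (rule stay_step[symmetric]) measurable
  finally show ?case .
qed

end

section \<open>From the grid to continuous time\<close>

definition survive :: "real \<Rightarrow> 'a set" where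
  "survive t = {\<omega> \<in> space M. \<forall>s\<in>{0..t}. H (B s \<omega>) > 0}"

definition above :: "real \<Rightarrow> real \<Rightarrow> 'a set" where
  "above \<eta> t = {\<omega> \<in> space M. \<forall>s\<in>{0..t}. H (B s \<omega>) \<ge> \<eta>}"

lemma continuous_H_path:
  assumes "\<omega> \<in> space M"
  shows "continuous_on {0..t} (\<lambda>s. H (B s \<omega>))"
proof -
  have "continuous_on {0..t} (\<lambda>s. B s \<omega>)"
    using continuous_paths[OF assms] by (rule continuous_on_subset) auto
  then show ?thesis
    using continuous_on_compose2[OF cont] by blast
qed

text \<open>A countable description, which yields measurability and places \<open>above\<close>
  inside every grid event. Conversely, a path that dips below \<open>\<eta>\<close> is caught by all
  fine grids.\<close>

lemma above_eq_stay:
  assumes t: "t > 0"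
  shows "above \<eta> t = (\<Inter>n. {\<omega> \<in> space M. \<omega> \<in> stay \<eta> (t / real (Suc n)) (Suc n)})"
proof (intro equalityI subsetI)
  fix \<omega> assume \<omega>: "\<omega> \<in> above \<eta> t"
  show "\<omega> \<in> (\<Inter>n. {\<omega> \<in> space M. \<omega> \<in> stay \<eta> (t / real (Suc n)) (Suc n)})"
  proof (rule INT_I)
    fix n
    have "real j * (t / real (Suc n)) \<in> {0..t}" if "j \<le> Suc n" for j
    proof -
      have "real j * t \<le> real (Suc n) * t" using that t by (intro mult_right_mono) auto
      then show ?thesis using t by (auto simp: divide_le_eq mult.commute simp del: of_nat_Suc)
    qed
    then show "\<omega> \<in> {\<omega> \<in> space M. \<omega> \<in> stay \<eta> (t / real (Suc n)) (Suc n)}"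
      using \<omega> by (auto simp: above_def stay_def simp del: of_nat_Suc)
  qed
next
  fix \<omega> assume \<omega>: "\<omega> \<in> (\<Inter>n. {\<omega> \<in> space M. \<omega> \<in> stay \<eta> (t / real (Suc n)) (Suc n)})"
  then have sp: "\<omega> \<in> space M" by blast
  have "H (B s \<omega>) \<ge> \<eta>" if s: "s \<in> {0..t}" for s
  proof (rule ccontr)
    assume "\<not> H (B s \<omega>) \<ge> \<eta>"
    then have "\<forall>\<^sub>F n in sequentially. \<exists>j\<le>Suc n. H (B (real j * (t / real (Suc n))) \<omega>) < \<eta>"
      by (intro grid_approx[OF t continuous_H_path[OF sp] s]) simp
    then obtain n j where "j \<le> Suc n" "H (B (real j * (t / real (Suc n))) \<omega>) < \<eta>"
      by (auto simp: eventually_sequentially)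
    moreover have "\<omega> \<in> stay \<eta> (t / real (Suc n)) (Suc n)" using \<omega> by blast
    ultimately show False unfolding stay_def by force
  qed
  then show "\<omega> \<in> above \<eta> t" using sp by (simp add: above_def)
qed

lemma sets_above: "t > 0 \<Longrightarrow> \<eta> > 0 \<Longrightarrow> above \<eta> t \<in> sets M"
  unfolding above_eq_stay by (intro sets.countable_INT) (auto intro!: measurable_stay)

lemma incseq_above: "incseq (\<lambda>i. above (1 / real (Suc i)) t)"
proof (rule incseq_SucI)
  fix i
  have "1 / real (Suc (Suc i)) \<le> 1 / real (Suc i)" by (simp add: field_simps)
  then show "above (1 / real (Suc i)) t \<subseteq> above (1 / real (Suc (Suc i))) t"
    unfolding above_def by (auto simp del: of_nat_Suc intro: order_trans)
qed

text \<open>A continuous path attains its minimum of \<open>H\<close> on the compact time interval,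
  so a surviving path stays above some positive level.\<close>

lemma survive_eq_above:
  assumes t: "t > 0"
  shows "survive t = (\<Union>i. above (1 / real (Suc i)) t)"
proof (intro equalityI subsetI)
  fix \<omega> assume \<omega>: "\<omega> \<in> survive t"
  then have sp: "\<omega> \<in> space M" by (simp add: survive_def)
  obtain s where s: "s \<in> {0..t}" "\<And>s'. s' \<in> {0..t} \<Longrightarrow> H (B s \<omega>) \<le> H (B s' \<omega>)"
    using continuous_attains_inf[OF compact_Icc _ continuous_H_path[OF sp, of t]] t by auto
  have "H (B s \<omega>) > 0" using \<omega> s(1) by (simp add: survive_def)
  then obtain i where "1 / real (Suc i) < H (B s \<omega>)"
    using reals_Archimedean by (auto simp: inverse_eq_divide)
  then have "\<omega> \<in> above (1 / real (Suc i)) t"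
    using sp s(2) unfolding above_def by (fastforce simp del: of_nat_Suc)
  then show "\<omega> \<in> (\<Union>i. above (1 / real (Suc i)) t)" by blast
next
  fix \<omega> assume "\<omega> \<in> (\<Union>i. above (1 / real (Suc i)) t)"
  then obtain i where "\<omega> \<in> above (1 / real (Suc i)) t" by blast
  moreover have "0 < 1 / real (Suc i)" by simp
  ultimately show "\<omega> \<in> survive t"
    unfolding above_def survive_def using less_le_trans by blast
qed

lemma sets_survive: "t > 0 \<Longrightarrow> survive t \<in> sets M"
  unfolding survive_eq_above by (intro sets.countable_UN) (auto intro!: sets_above)

text \<open>The event lies in every grid event, so the grid bound holds for each \<open>n\<close>
  and the accumulated jump error tends to 0.\<close>

lemma above_upper:
  assumes t: "t > 0" and \<eta>: "\<eta> > 0" and m: "m \<ge> 0"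
  shows "(\<integral>\<^sup>+\<omega>. ennreal (min (H (B t \<omega>)) m) * indicator (above \<eta> t) \<omega> \<partial>M) \<le> ennreal (H z)"
proof -
  obtain r where r: "r > 0" "\<And>w. H w \<ge> \<eta> \<Longrightarrow> ball w r \<subseteq> {w. H w > 0}"
    using level_set_ball[OF \<eta>] by blast
  let ?e = "\<lambda>n. real (Suc n) * (2 * exp (- r\<^sup>2 / (4 * (t / real (Suc n)))))"
  let ?I = "\<integral>\<^sup>+\<omega>. ennreal (min (H (B t \<omega>)) m) * indicator (above \<eta> t) \<omega> \<partial>M"
  have "?I \<le> ennreal (H z + m * ?e n)" for n
  proof -
    define d where "d = t / real (Suc n)"
    have d: "d > 0" "real (Suc n) * d = t" using t by (auto simp: d_def)
    let ?q = "\<integral>\<^sup>+x. ennreal (planar_heat_kernel d 0 x) * indicator (- ball 0 r) x \<partial>lborel"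
    have "?I \<le> (\<integral>\<^sup>+\<omega>. ennreal (min (H (B (real (Suc n) * d) \<omega>)) m) * indicator (stay \<eta> d (Suc n)) \<omega> \<partial>M)"
      using above_eq_stay[OF t, of \<eta>] unfolding d(2)
      by (intro nn_integral_mono) (auto simp: d_def indicator_def simp del: of_nat_Suc)
    also have "\<dots> \<le> ennreal (min (H z) m) + of_nat (Suc n) * (ennreal m * ?q)"
      by (rule stay_upper[OF \<eta> d(1) r(2) m])
    also have "\<dots> \<le> ennreal (H z) + of_nat (Suc n) * (ennreal m * ennreal (2 * exp (- r\<^sup>2 / (4 * d))))"
      using d(1) r(1) by (intro add_mono mult_left_mono planar_heat_kernel_tail nn_integral_heat_kernel ennreal_leI) auto
    also have "\<dots> = ennreal (H z + m * ?e n)"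
      using m nonneg[of z]
      by (simp add: d_def ennreal_of_nat_eq_real_of_nat mult_ac flip: ennreal_mult ennreal_plus del: of_nat_Suc)
    finally show ?thesis .
  qed
  moreover have "(\<lambda>n. H z + m * ?e n) \<longlonglongrightarrow> H z + m * 0"
    by (intro tendsto_intros gaussian_tail_sum_tendsto t r)
  then have "(\<lambda>n. ennreal (H z + m * ?e n)) \<longlonglongrightarrow> ennreal (H z)"
    by (intro tendsto_ennrealI) simp
  ultimately show ?thesis by (intro LIMSEQ_le_const) auto
qed

lemma measurable_H_B: "t \<ge> 0 \<Longrightarrow> (\<lambda>\<omega>. H (B t \<omega>)) \<in> borel_measurable M"
  by (rule measurable_compose[OF measurable_B measurable_H])

lemma survive_upper:
  assumes t: "t > 0" and m: "m \<ge> 0"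
  shows "(\<integral>\<^sup>+\<omega>. ennreal (min (H (B t \<omega>)) m) * indicator (survive t) \<omega> \<partial>M) \<le> ennreal (H z)"
proof -
  have [measurable]: "(\<lambda>\<omega>. H (B t \<omega>)) \<in> borel_measurable M" using t by (intro measurable_H_B) simp
  \<comment> \<open>As a measure of the event, the integral is continuous along the increasing
    events, which lets the level tend to 0.\<close>
  let ?D = "density M (\<lambda>\<omega>. ennreal (min (H (B t \<omega>)) m))"
  have em: "emeasure ?D A = (\<integral>\<^sup>+\<omega>. ennreal (min (H (B t \<omega>)) m) * indicator A \<omega> \<partial>M)" if "A \<in> sets M" for A
    using that by (intro emeasure_density) auto
  have ab: "above (1 / real (Suc i)) t \<in> sets M" for i using t by (intro sets_above) auto
  have "emeasure ?D (survive t) = (SUP i. emeasure ?D (above (1 / real (Suc i)) t))"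
    unfolding survive_eq_above[OF t] using ab
    by (intro SUP_emeasure_incseq[symmetric] incseq_above) (auto simp del: of_nat_Suc)
  also have "\<dots> \<le> ennreal (H z)"
    unfolding em[OF ab] using t m by (intro SUP_least above_upper) auto
  finally show ?thesis using em[OF sets_survive[OF t]] by simp
qed

section \<open>Integrability and the lower bound for the surviving mean\<close>

text \<open>A soft cutoff at radius \<open>R\<close>: the constant part will be multiplied by the
  survival probability, while the quadratic part has expectation of order
  \<open>t / R\<^sup>2\<close> for large \<open>t\<close>, by the second moment.\<close>

lemma H_growth:
  assumes "R \<ge> 1"
  shows "pi * H w \<le> C + ln R + (norm w)\<^sup>2 / R\<^sup>2"
proof -
  have "ln (max 1 (norm w)) \<le> ln R + (norm w)\<^sup>2 / R\<^sup>2"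
  proof (cases "norm w \<le> R")
    case True
    then have "ln (max 1 (norm w)) \<le> ln R" using assms by simp
    then show ?thesis by (smt (verit) zero_le_divide_iff zero_le_power2)
  next
    case False
    have "norm w > 0" "R > 0" using False assms by linarith+
    then have "ln (norm w) = ln R + ln (norm w / R)" by (simp add: ln_div)
    also have "ln (norm w / R) \<le> norm w / R - 1"
      using \<open>norm w > 0\<close> \<open>R > 0\<close> by (intro ln_le_minus_one divide_pos_pos)
    also have "\<dots> \<le> norm w / R" by simp
    also have "\<dots> \<le> (norm w / R)\<^sup>2"
      using False assms by (intro self_le_power) auto
    finally show ?thesis using False assms by (simp add: power_divide)
  qed
  then show ?thesis using upper[of w] by linarith
qed

lemma second_moment:
  assumes t: "t > 0"
  shows "(\<integral>\<^sup>+\<omega>. ennreal ((norm (B t \<omega>))\<^sup>2) \<partial>M) \<le> ennreal (2 * (norm z)\<^sup>2 + 16 * t)"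
proof -
  have [measurable]: "(\<lambda>\<omega>. B t \<omega> - B 0 \<omega>) \<in> borel_measurable M"
    using distributed_from_start[OF t] by (simp add: distributed_def)
  have "(\<integral>\<^sup>+\<omega>. ennreal ((norm (B t \<omega>))\<^sup>2) \<partial>M) \<le>
      (\<integral>\<^sup>+\<omega>. ennreal (2 * (norm z)\<^sup>2) + 2 * ennreal ((norm (B t \<omega> - B 0 \<omega>))\<^sup>2) \<partial>M)"
  proof (rule nn_integral_mono)
    fix \<omega> assume \<omega>: "\<omega> \<in> space M"
    have "norm (B t \<omega>) \<le> norm z + norm (B t \<omega> - B 0 \<omega>)"
      using norm_triangle_sub[of "B t \<omega>" z] B_0[OF \<omega>] by simp
    then have "(norm (B t \<omega>))\<^sup>2 \<le> (norm z + norm (B t \<omega> - B 0 \<omega>))\<^sup>2"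
      by (intro power_mono) auto
    also have "\<dots> \<le> 2 * (norm z)\<^sup>2 + 2 * (norm (B t \<omega> - B 0 \<omega>))\<^sup>2"
      using sum_squares_ge_zero[of "norm z - norm (B t \<omega> - B 0 \<omega>)" 0]
      by (simp add: power2_eq_square algebra_simps)
    finally have "ennreal ((norm (B t \<omega>))\<^sup>2) \<le> ennreal (2 * (norm z)\<^sup>2 + 2 * (norm (B t \<omega> - B 0 \<omega>))\<^sup>2)"
      by (rule ennreal_leI)
    also have "\<dots> = ennreal (2 * (norm z)\<^sup>2) + 2 * ennreal ((norm (B t \<omega> - B 0 \<omega>))\<^sup>2)"
      by (simp add: ennreal_plus ennreal_mult')
    finally show "ennreal ((norm (B t \<omega>))\<^sup>2) \<le> ennreal (2 * (norm z)\<^sup>2) + 2 * ennreal ((norm (B t \<omega> - B 0 \<omega>))\<^sup>2)" .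
  qed
  also have "\<dots> = ennreal (2 * (norm z)\<^sup>2) + 2 * (\<integral>\<^sup>+\<omega>. ennreal ((norm (B t \<omega> - B 0 \<omega>))\<^sup>2) \<partial>M)"
    by (simp add: nn_integral_add nn_integral_cmult emeasure_space_1)
  also have "(\<integral>\<^sup>+\<omega>. ennreal ((norm (B t \<omega> - B 0 \<omega>))\<^sup>2) \<partial>M) =
      (\<integral>\<^sup>+w. ennreal (planar_heat_kernel t 0 w) * ennreal ((norm w)\<^sup>2) \<partial>lborel)"
    by (rule distributed_nn_integral[OF distributed_from_start[OF t], symmetric]) measurable
  also have "\<dots> \<le> ennreal (8 * t)"
    using t by (intro planar_heat_kernel_second_moment nn_integral_heat_kernel) auto
  also have "ennreal (2 * (norm z)\<^sup>2) + 2 * ennreal (8 * t) = ennreal (2 * (norm z)\<^sup>2 + 16 * t)"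
    using t by (simp add: ennreal_plus flip: ennreal_numeral ennreal_mult')
  finally show ?thesis by (meson add_left_mono mult_left_mono zero_le)
qed

text \<open>Provides the integrable majorant for the dominated convergence in
  \<open>survive_lower_aux\<close>, where \<open>H\<close> is not capped.\<close>

lemma H_B_finite:
  assumes t: "t > 0"
  shows "(\<integral>\<^sup>+\<omega>. ennreal (H (B t \<omega>)) \<partial>M) < \<infinity>"
proof -
  have [measurable]: "B t \<in> borel_measurable M" using t by simp
  have "(\<integral>\<^sup>+\<omega>. ennreal (H (B t \<omega>)) \<partial>M) \<le> (\<integral>\<^sup>+\<omega>. ennreal \<bar>C\<bar> + ennreal ((norm (B t \<omega>))\<^sup>2) \<partial>M)"
  proof (rule nn_integral_mono)
    fix \<omega>
    have "1 * H (B t \<omega>) \<le> pi * H (B t \<omega>)"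
      using nonneg pi_gt3 by (intro mult_right_mono) auto
    also have "\<dots> \<le> \<bar>C\<bar> + (norm (B t \<omega>))\<^sup>2"
      using H_growth[of 1 "B t \<omega>"] by simp
    finally show "ennreal (H (B t \<omega>)) \<le> ennreal \<bar>C\<bar> + ennreal ((norm (B t \<omega>))\<^sup>2)"
      by (simp add: ennreal_leI flip: ennreal_plus)
  qed
  also have "\<dots> = ennreal \<bar>C\<bar> + (\<integral>\<^sup>+\<omega>. ennreal ((norm (B t \<omega>))\<^sup>2) \<partial>M)"
    by (subst nn_integral_add) (auto simp: emeasure_space_1)
  also have "\<dots> \<le> ennreal \<bar>C\<bar> + ennreal (2 * (norm z)\<^sup>2 + 16 * t)"
    by (intro add_left_mono second_moment t)
  also have "\<dots> < \<infinity>" by (simp add: ennreal_add_eq_top less_top)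
  finally show ?thesis .
qed

text \<open>Bernoulli's inequality turns the product of the \<open>k\<close> losses into a sum,
  which is the same error as in the upper bound. The cut at 0 handles coarse grids, for which the
  tail bound \<open>e\<close> exceeds 1.\<close>

lemma stay_lower_tail:
  assumes d: "d > 0" and \<eta>: "\<eta> > 0" and r: "r > 0" "\<And>w. H w \<ge> \<eta> \<Longrightarrow> ball w r \<subseteq> {w. H w > 0}"
  shows "ennreal (max (H z - \<eta>) 0 * (1 - real k * (2 * exp (- r\<^sup>2 / (4 * d))))) \<le>
    (\<integral>\<^sup>+\<omega>. ennreal (max (H (B (real k * d) \<omega>) - \<eta>) 0) * indicator (stay \<eta> d k) \<omega> \<partial>M)"
proof -
  define e where "e = 2 * exp (- r\<^sup>2 / (4 * d))"
  define q where "q = (\<integral>\<^sup>+x. ennreal (planar_heat_kernel d 0 x) * indicator (ball 0 r) x \<partial>lborel)"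
  define p where "p = (\<integral>\<^sup>+x. ennreal (planar_heat_kernel d 0 x) * indicator (- ball 0 r) x \<partial>lborel)"
  have e: "e \<ge> 0" by (simp add: e_def)
  have "q + p = 1"
    using nn_integral_ball_split[of "\<lambda>x. ennreal (planar_heat_kernel d 0 x)" r] nn_integral_heat_kernel[OF d]
    by (simp add: q_def p_def)
  moreover have "p \<le> ennreal e"
    unfolding p_def e_def using d r by (intro planar_heat_kernel_tail nn_integral_heat_kernel) auto
  ultimately have 1: "1 \<le> q + ennreal e" by (metis add_left_mono)
  have "ennreal (max 0 (1 - e)) \<le> q"
  proof (cases q)
    case (real q')
    then have "ennreal 1 \<le> ennreal (q' + e)" using 1 e by simp
    then have "1 \<le> q' + e" using real e by (subst (asm) ennreal_le_iff) auto
    then show ?thesis using real by (auto intro!: ennreal_leI)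
  qed simp
  then have "ennreal (max 0 (1 - e)) ^ k \<le> q ^ k" by (rule power_mono) simp
  also have "ennreal (max 0 (1 - e)) ^ k = ennreal (max 0 (1 - e) ^ k)" by (rule ennreal_power) simp
  finally have pow: "ennreal (max 0 (1 - e) ^ k) \<le> q ^ k" .
  have bern: "1 - real k * e \<le> max 0 (1 - e) ^ k"
  proof (cases "e \<le> 1")
    case True
    then show ?thesis using Bernoulli_inequality[of "- e" k] by simp
  next
    case False
    have "1 - real k * e \<le> 0 ^ k"
    proof (cases k)
      case (Suc m)
      have "1 * 1 \<le> real k * e" using False Suc by (intro mult_mono) auto
      then show ?thesis using Suc by simp
    qed simp
    then show ?thesis using False by (simp add: max_def)
  qed
  have "ennreal (max (H z - \<eta>) 0 * (1 - real k * e)) \<le> ennreal (max (H z - \<eta>) 0 * max 0 (1 - e) ^ k)"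
    using bern by (intro ennreal_leI mult_left_mono) auto
  also have "\<dots> = ennreal (max (H z - \<eta>) 0) * ennreal (max 0 (1 - e) ^ k)"
    by (rule ennreal_mult) auto
  also have "\<dots> \<le> ennreal (max (H z - \<eta>) 0) * q ^ k"
    using pow by (rule mult_left_mono) simp
  also have "\<dots> \<le> (\<integral>\<^sup>+\<omega>. ennreal (max (H (B (real k * d) \<omega>) - \<eta>) 0) * indicator (stay \<eta> d k) \<omega> \<partial>M)"
    unfolding q_def by (rule stay_lower[OF \<eta> d r(2)])
  finally show ?thesis unfolding e_def .
qed

text \<open>The grid event also contains paths that hit the zero set between grid times. For each
  such path fine grids see a value below \<open>\<eta>\<close>, so this surplus tends to 0
  pointwise, and in the mean by dominated convergence.\<close>

lemma survive_lower_aux: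
  assumes t: "t > 0" and \<eta>: "\<eta> > 0"
  shows "ennreal (H z - \<eta>) \<le> (\<integral>\<^sup>+\<omega>. ennreal (H (B t \<omega>)) * indicator (survive t) \<omega> \<partial>M)"
proof -
  obtain r where r: "r > 0" "\<And>w. H w \<ge> \<eta> \<Longrightarrow> ball w r \<subseteq> {w. H w > 0}"
    using level_set_ball[OF \<eta>] by blast
  define d where "d n = t / real (Suc n)" for n
  have d: "d n > 0" "real (Suc n) * d n = t" for n using t by (auto simp: d_def)
  define v where "v \<omega> = ennreal (max (H (B t \<omega>) - \<eta>) 0)" for \<omega>
  have [measurable]: "B t \<in> borel_measurable M" using t by simp
  have [measurable]: "v \<in> borel_measurable M" unfolding v_def by measurable
  have [measurable]: "survive t \<in> sets M" by (rule sets_survive[OF t])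
  have [measurable]: "(indicator (stay \<eta> (d n) k) :: 'a \<Rightarrow> ennreal) \<in> borel_measurable M" for n k
    by (rule measurable_stay_indicator[OF d(1)])
  have vH: "v \<omega> \<le> ennreal (H (B t \<omega>))" for \<omega>
    unfolding v_def using \<eta> nonneg[of "B t \<omega>"] by (intro ennreal_leI) auto
  let ?e = "\<lambda>n. real (Suc n) * (2 * exp (- r\<^sup>2 / (4 * (t / real (Suc n)))))"
  let ?I = "\<integral>\<^sup>+\<omega>. ennreal (H (B t \<omega>)) * indicator (survive t) \<omega> \<partial>M"
  \<comment> \<open>The surplus: walks that stay above \<open>\<eta>\<close> on the grid although
    the path does not survive.\<close>
  let ?u = "\<lambda>n \<omega>. v \<omega> * indicator (stay \<eta> (d n) (Suc n)) \<omega> * indicator (space M - survive t) \<omega>"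
  let ?J = "\<lambda>n. \<integral>\<^sup>+\<omega>. ?u n \<omega> \<partial>M"
  have "ennreal (max (H z - \<eta>) 0 * (1 - ?e n)) \<le> ?I + ?J n" for n
  proof -
    have "ennreal (max (H z - \<eta>) 0 * (1 - real (Suc n) * (2 * exp (- r\<^sup>2 / (4 * d n))))) \<le>
        (\<integral>\<^sup>+\<omega>. ennreal (max (H (B (real (Suc n) * d n) \<omega>) - \<eta>) 0) * indicator (stay \<eta> (d n) (Suc n)) \<omega> \<partial>M)"
      by (rule stay_lower_tail[OF d(1) \<eta> r])
    then have "ennreal (max (H z - \<eta>) 0 * (1 - ?e n)) \<le> (\<integral>\<^sup>+\<omega>. v \<omega> * indicator (stay \<eta> (d n) (Suc n)) \<omega> \<partial>M)"
      unfolding d(2) v_def by (simp only: d_def)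
    also have "\<dots> \<le> (\<integral>\<^sup>+\<omega>. ennreal (H (B t \<omega>)) * indicator (survive t) \<omega> + ?u n \<omega> \<partial>M)"
      using vH by (intro nn_integral_mono) (auto simp: indicator_def)
    also have "\<dots> = ?I + ?J n"
      by (rule nn_integral_add) measurable
    finally show ?thesis .
  qed
  moreover have "(\<lambda>n. ennreal (max (H z - \<eta>) 0 * (1 - ?e n))) \<longlonglongrightarrow> ennreal (max (H z - \<eta>) 0 * (1 - 0))"
    by (intro tendsto_intros tendsto_ennrealI gaussian_tail_sum_tendsto t r)
  moreover have "?J \<longlonglongrightarrow> (\<integral>\<^sup>+\<omega>. 0 \<partial>M)"
  proof (rule nn_integral_dominated_convergence[where w = v])
    show "AE \<omega> in M. ?u n \<omega> \<le> v \<omega>" for n by (rule AE_I2) (auto simp: indicator_def)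
    have "(\<integral>\<^sup>+\<omega>. v \<omega> \<partial>M) \<le> (\<integral>\<^sup>+\<omega>. ennreal (H (B t \<omega>)) \<partial>M)" using vH by (intro nn_integral_mono)
    then show "(\<integral>\<^sup>+\<omega>. v \<omega> \<partial>M) < \<infinity>" using H_B_finite[OF t] by (rule order_le_less_trans)
    show "AE \<omega> in M. (\<lambda>n. ?u n \<omega>) \<longlonglongrightarrow> 0"
    proof (rule AE_I2)
      fix \<omega> assume \<omega>: "\<omega> \<in> space M"
      show "(\<lambda>n. ?u n \<omega>) \<longlonglongrightarrow> 0"
      proof (cases "\<omega> \<in> survive t")
        case False
        then obtain s where s: "s \<in> {0..t}" "H (B s \<omega>) < \<eta>"
          using \<omega> \<eta> unfolding survive_def by (auto simp: not_less)
        have "\<forall>\<^sub>F n in sequentially. \<exists>j\<le>Suc n. H (B (real j * d n) \<omega>) < \<eta>"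
          unfolding d_def using s by (intro grid_approx[OF t continuous_H_path[OF \<omega>]])
        then have "\<forall>\<^sub>F n in sequentially. ?u n \<omega> = 0"
          by eventually_elim (auto simp: stay_def indicator_def not_le)
        then show ?thesis by (rule tendsto_eventually)
      qed simp
    qed
  qed measurable
  then have "(\<lambda>n. ?I + ?J n) \<longlonglongrightarrow> ?I + 0"
    by (intro tendsto_intros) simp
  ultimately have "ennreal (max (H z - \<eta>) 0 * (1 - 0)) \<le> ?I + 0"
    by (intro LIMSEQ_le[of _ _ "\<lambda>n. ?I + ?J n"]) blast+
  moreover have "ennreal (H z - \<eta>) \<le> ennreal (max (H z - \<eta>) 0 * (1 - 0))"
    by (intro ennreal_leI) simp
  ultimately show ?thesis by simp
qed

lemma survive_lower:
  assumes t: "t > 0"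
  shows "ennreal (H z) \<le> (\<integral>\<^sup>+\<omega>. ennreal (H (B t \<omega>)) * indicator (survive t) \<omega> \<partial>M)"
proof -
  have "(\<lambda>n. H z - 1 / real (Suc n)) \<longlonglongrightarrow> H z - 0"
    by (intro tendsto_intros LIMSEQ_Suc[OF lim_const_over_n])
  then have "(\<lambda>n. ennreal (H z - 1 / real (Suc n))) \<longlonglongrightarrow> ennreal (H z)"
    by (intro tendsto_ennrealI) simp
  then show ?thesis
    by (rule LIMSEQ_le_const2) (auto intro!: survive_lower_aux[OF t])
qed

section \<open>Two-sided bounds for the survival probability\<close>

lemma C_nonneg: "C \<ge> 0"
  using upper[of 0] nonneg[of 0] by (smt (verit) ln_one max_def norm_zero pi_gt_zero zero_le_mult_iff)

text \<open>\<open>H_growth\<close> is integrated over the surviving paths; in the quadratic term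
  the restriction to them is dropped, so the full second moment bounds it.\<close>

lemma survival_prob_lower:
  assumes t: "t > 0" and R: "R \<ge> 1"
  shows "pi * H z \<le> (C + ln R) * prob (survive t) + (2 * (norm z)\<^sup>2 + 16 * t) / R\<^sup>2"
proof -
  have [measurable]: "B t \<in> borel_measurable M" using t by simp
  have [measurable]: "survive t \<in> sets M" by (rule sets_survive[OF t])
  have CR: "C + ln R \<ge> 0" using C_nonneg R by simp
  have "ennreal (pi * H z) = ennreal pi * ennreal (H z)" by (rule ennreal_mult) (auto simp: nonneg)
  also have "\<dots> \<le> ennreal pi * (\<integral>\<^sup>+\<omega>. ennreal (H (B t \<omega>)) * indicator (survive t) \<omega> \<partial>M)"
    by (intro mult_left_mono survive_lower t) simp
  also have "\<dots> = (\<integral>\<^sup>+\<omega>. ennreal pi * (ennreal (H (B t \<omega>)) * indicator (survive t) \<omega>) \<partial>M)"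
    by (rule nn_integral_cmult[symmetric]) measurable
  also have "\<dots> \<le> (\<integral>\<^sup>+\<omega>. ennreal (C + ln R) * indicator (survive t) \<omega> + ennreal (1 / R\<^sup>2) * ennreal ((norm (B t \<omega>))\<^sup>2) \<partial>M)"
  proof (rule nn_integral_mono)
    fix \<omega>
    have "ennreal pi * ennreal (H (B t \<omega>)) = ennreal (pi * H (B t \<omega>))"
      by (rule ennreal_mult[symmetric]) (auto simp: nonneg)
    also have "\<dots> \<le> ennreal (C + ln R + 1 / R\<^sup>2 * (norm (B t \<omega>))\<^sup>2)"
      using H_growth[OF R, of "B t \<omega>"] by (intro ennreal_leI) simp
    also have "\<dots> = ennreal (C + ln R) + ennreal (1 / R\<^sup>2) * ennreal ((norm (B t \<omega>))\<^sup>2)"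
      using CR by (subst ennreal_plus) (auto simp: ennreal_mult[of "1 / R\<^sup>2", symmetric] simp del: ennreal_plus)
    finally show "ennreal pi * (ennreal (H (B t \<omega>)) * indicator (survive t) \<omega>) \<le>
        ennreal (C + ln R) * indicator (survive t) \<omega> + ennreal (1 / R\<^sup>2) * ennreal ((norm (B t \<omega>))\<^sup>2)"
      by (simp add: indicator_def)
  qed
  also have "\<dots> = ennreal (C + ln R) * emeasure M (survive t) + ennreal (1 / R\<^sup>2) * (\<integral>\<^sup>+\<omega>. ennreal ((norm (B t \<omega>))\<^sup>2) \<partial>M)"
    by (simp add: nn_integral_add nn_integral_cmult)
  also have "\<dots> \<le> ennreal (C + ln R) * emeasure M (survive t) + ennreal (1 / R\<^sup>2) * ennreal (2 * (norm z)\<^sup>2 + 16 * t)"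
    by (intro add_left_mono mult_left_mono second_moment t) simp
  also have "\<dots> = ennreal ((C + ln R) * prob (survive t) + (2 * (norm z)\<^sup>2 + 16 * t) / R\<^sup>2)"
    using CR t by (simp add: emeasure_eq_measure flip: ennreal_mult ennreal_plus)
  finally show ?thesis
    using CR t by (subst (asm) ennreal_le_iff) auto
qed

text \<open>The density is at most \<open>1 / (2 * pi * t)\<close> and the disc has area
  \<open>pi * R\<^sup>2\<close>.\<close>

lemma prob_B_ball:
  assumes t: "t > 0" and R: "R \<ge> 0"
  shows "prob {\<omega> \<in> space M. norm (B t \<omega>) < R} \<le> R\<^sup>2 / (2 * t)"
proof -
  have "{\<omega> \<in> space M. norm (B t \<omega>) < R} = (\<lambda>\<omega>. B t \<omega> - B 0 \<omega>) -` ball (- z) R \<inter> space M"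
    by (auto simp: B_0 dist_norm norm_minus_commute)
  then have "emeasure M {\<omega> \<in> space M. norm (B t \<omega>) < R} =
      (\<integral>\<^sup>+w. ennreal (planar_heat_kernel t 0 w) * indicator (ball (- z) R) w \<partial>lborel)"
    using distributed_emeasure[OF distributed_from_start[OF t], of "ball (- z) R"] by simp
  also have "\<dots> \<le> (\<integral>\<^sup>+w. ennreal (1 / (2 * pi * t)) * indicator (ball (- z) R) w \<partial>lborel)"
    using t by (intro nn_integral_mono mult_right_mono ennreal_leI)
      (auto simp: planar_heat_kernel_def intro!: divide_right_mono)
  also have "\<dots> = ennreal (1 / (2 * pi * t)) * emeasure lborel (ball (- z) R)"
    by (rule nn_integral_cmult_indicator) simp
  also have "\<dots> = ennreal (R\<^sup>2 / (2 * t))"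
    using t R by (simp add: emeasure_ball eval_unit_ball_vol flip: ennreal_mult)
  finally show ?thesis
    using t by (simp add: emeasure_eq_measure)
qed

lemma survival_prob_upper:
  assumes t: "t > 0" and R: "R > 0" "R \<ge> R\<^sub>0" "ln R > C"
  shows "prob (survive t) \<le> R\<^sup>2 / (2 * t) + pi * H z / (ln R - C)"
proof -
  \<comment> \<open>The value that \<open>lower\<close> guarantees for \<open>H\<close> off the disc
    of radius \<open>R\<close>, so the capped function equals \<open>m\<close> there and Markov's
    inequality applies.\<close>
  define m where "m = (ln R - C) / pi"
  have m: "m > 0" using R by (simp add: m_def)
  let ?A = "{\<omega> \<in> space M. norm (B t \<omega>) < R}"
  have [measurable]: "B t \<in> borel_measurable M" using t by simp
  have [measurable]: "survive t \<in> sets M" by (rule sets_survive[OF t])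
  have A [measurable]: "?A \<in> sets M" by measurable
  have "ennreal m * emeasure M (survive t) = (\<integral>\<^sup>+\<omega>. ennreal m * indicator (survive t) \<omega> \<partial>M)"
    by (rule nn_integral_cmult_indicator[symmetric]) simp
  also have "\<dots> \<le> (\<integral>\<^sup>+\<omega>. ennreal (min (H (B t \<omega>)) m) * indicator (survive t) \<omega> + ennreal m * indicator ?A \<omega> \<partial>M)"
  proof (rule nn_integral_mono)
    fix \<omega> assume \<omega>: "\<omega> \<in> space M"
    show "ennreal m * indicator (survive t) \<omega> \<le> ennreal (min (H (B t \<omega>)) m) * indicator (survive t) \<omega> + ennreal m * indicator ?A \<omega>"
    proof (cases "\<omega> \<in> ?A")
      case False
      then have n: "norm (B t \<omega>) \<ge> R" using \<omega> by auto
      then have "ln R \<le> ln (norm (B t \<omega>))" using R(1) by (intro ln_mono) auto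
      then have "ln R - C \<le> pi * H (B t \<omega>)"
        using lower[of "B t \<omega>"] n R by linarith
      then have "m \<le> H (B t \<omega>)" by (simp add: m_def field_simps)
      then show ?thesis by (simp add: min_def)
    qed (auto simp: indicator_def)
  qed
  also have "\<dots> = (\<integral>\<^sup>+\<omega>. ennreal (min (H (B t \<omega>)) m) * indicator (survive t) \<omega> \<partial>M) + ennreal m * emeasure M ?A"
    by (subst nn_integral_add) (auto simp: nn_integral_cmult)
  also have "\<dots> \<le> ennreal (H z) + ennreal m * emeasure M ?A"
    using m by (intro add_right_mono survive_upper t) simp
  finally have "m * prob (survive t) \<le> H z + m * prob ?A"
    using m nonneg[of z] by (simp add: emeasure_eq_measure flip: ennreal_mult ennreal_plus)
  also have "\<dots> \<le> H z + m * (R\<^sup>2 / (2 * t))"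
    using m R t by (intro add_left_mono mult_left_mono prob_B_ball) auto
  finally have "prob (survive t) \<le> (H z + m * (R\<^sup>2 / (2 * t))) / m"
    using m by (simp add: le_divide_eq mult.commute)
  also have "\<dots> = R\<^sup>2 / (2 * t) + H z / m"
    using m by (simp add: add_divide_distrib)
  also have "H z / m = pi * H z / (ln R - C)"
    by (simp add: m_def)
  finally show ?thesis .
qed

end

section \<open>Asymptotics of the hitting probability\<close>

text \<open>To leading order the numerator is \<open>4 * h * ln (ln t) / (ln t)\<^sup>2\<close> and
  the denominator \<open>2 * ln (ln t) / (ln t)\<^sup>2\<close>. With \<open>h = pi * H z\<close>
  the limit is the constant of the theorem; terms of order \<open>1 / (ln t)\<^sup>2\<close>
  disappear.\<close>

lemma upper_error_asymptotics:
  fixes h C k :: real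
  assumes "h > 0"
  shows "((\<lambda>t. (1 / (2 * (ln t)\<^sup>2) + h / (ln t / 2 - ln (ln t) - C) - 2 * h / (ln t - k)) /
    (ln ((ln t - k)\<^sup>2) / (ln t - k)\<^sup>2)) \<longlongrightarrow> 2 * h) at_top"
  using assms by real_asymp

text \<open>The radius \<open>sqrt (t * ln t)\<close> shifts its logarithm by half of
  \<open>ln (ln t)\<close>, against a whole one on the other side, so the limit is only
  \<open>h\<close> and this direction has room to spare.\<close>

lemma lower_error_asymptotics:
  fixes h C k a :: real
  assumes "h > 0"
  shows "((\<lambda>t. (2 * h / (ln t - k) - (h - (a + 16 * t) / (t * ln t)) / (C + (ln t + ln (ln t)) / 2)) /
    (ln ((ln t - k)\<^sup>2) / (ln t - k)\<^sup>2)) \<longlongrightarrow> h) at_top"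
  using assms by real_asymp

text \<open>\<open>H\<close> vanishes also in the holes of \<open>T\<close>, but a path that starts
  in the exterior and avoids \<open>T\<close> cannot enter them, because its image is
  connected.\<close>

lemma (in brownian_green) survive_eq_not_hit:
  assumes T: "compact T" and z: "z \<in> outside T" and pos: "\<And>w. H w > 0 \<longleftrightarrow> w \<in> outside T" and t: "t \<ge> 0"
  shows "survive t = space M - {\<omega> \<in> space M. \<exists>s\<in>{0..t}. B s \<omega> \<in> T}"
proof -
  have "B s \<omega> \<in> outside T" if \<omega>: "\<omega> \<in> space M" and avoid: "\<And>s. s \<in> {0..t} \<Longrightarrow> B s \<omega> \<notin> T" and s: "s \<in> {0..t}" for s \<omega>
  proof -
    let ?S = "(\<lambda>s. B s \<omega>) ` {0..t}"
    have "connected ?S"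
      using continuous_paths[OF \<omega>] by (intro connected_continuous_image) (auto intro: continuous_on_subset)
    moreover have "?S \<subseteq> inside T \<union> outside T"
      using avoid inside_Un_outside[of T] by blast
    moreover have "inside T \<inter> outside T \<inter> ?S = {}"
      using inside_Int_outside[of T] by blast
    moreover have "open (inside T)" "open (outside T)"
      using T by (auto simp: open_inside open_outside compact_imp_closed)
    moreover have "B 0 \<omega> \<in> ?S" using t by (intro imageI) simp
    then have "z \<in> outside T \<inter> ?S" using z B_0[OF \<omega>] by simp
    ultimately have "inside T \<inter> ?S = {}"
      unfolding connected_def by blast
    moreover have "B s \<omega> \<in> ?S" using s by blast
    ultimately show ?thesis using \<open>?S \<subseteq> inside T \<union> outside T\<close> by blast
  qed
  then show ?thesis
    using outside_no_overlap[of T] unfolding survive_def pos by blast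
qed

theorem corollary1p4:
  fixes T :: "complex set" and z :: complex
    and M :: "'a measure" and B :: "real \<Rightarrow> 'a \<Rightarrow> complex"
    and \<tau>\<^sub>0 :: real
  assumes "connected T" and "compact T" and "T \<noteq> {}" and "\<forall>a. T \<noteq> {a}"
    and "z \<in> outside T"
    and "planar_brownian_motion M B z"
    and "\<tau>\<^sub>0 = 1 / 2 * exp (2 * euler_mascheroni) * (conformal_radius T)\<^sup>2"
  shows "\<exists>\<epsilon> :: real \<Rightarrow> real. (\<epsilon> \<longlongrightarrow> 0) at_top \<and>
    (\<forall>\<^sub>F t in at_top.
       \<bar>hitting_prob M B T t - (1 - 2 * pi * green_infinity T z / ln (t / \<tau>\<^sub>0))\<bar>
       \<le> ln ((ln (t / \<tau>\<^sub>0))\<^sup>2) / (ln (t / \<tau>\<^sub>0))\<^sup>2 * (2 * pi * green_infinity T z + \<epsilon> t))"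
proof -
  obtain a where a: "a \<in> T" using assms(3) by blast
  then obtain b where b: "b \<in> T" "a \<noteq> b" using assms(4) by blast
  obtain \<Phi> c where ext: "is_exterior_map T \<Phi> c"
    using exterior_map_exists[OF assms(2,1) a b] by blast
  have "c > 0" by (rule exterior_map_pos[OF ext assms(2)])
  then have \<tau>: "\<tau>\<^sub>0 > 0" unfolding assms(7) conformal_radius_eq[OF assms(2) ext] by simp
  define k where "k = ln \<tau>\<^sub>0"
  define H where "H = green_infinity T"
  have pos: "H w > 0 \<longleftrightarrow> w \<in> outside T" for w
    unfolding H_def by (rule green_infinity_is_green_function(2)[OF assms(2) ext])
  obtain C R\<^sub>0 where "green_function H C R\<^sub>0"
    using green_infinity_is_green_function(1)[OF assms(2) ext] unfolding H_def by blast
  then interpret green_function H C R\<^sub>0 .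
  interpret planar_brownian M B z by unfold_locales (rule assms(6))
  interpret brownian_green M B z H C R\<^sub>0 ..
  define h where "h = pi * H z"
  have h: "h > 0" using pos assms(5) by (simp add: h_def)
  define p where "p t = prob (survive t)" for t
  define g where "g t = ln ((ln t - k)\<^sup>2) / (ln t - k)\<^sup>2" for t
  define U where "U t = 1 / (2 * (ln t)\<^sup>2) + h / (ln t / 2 - ln (ln t) - C)" for t
  define L where "L t = (h - (2 * (norm z)\<^sup>2 + 16 * t) / (t * ln t)) / (C + (ln t + ln (ln t)) / 2)" for t
  have hit: "hitting_prob M B T t = 1 - p t" if "t > 0" for t
  proof -
    let ?A = "{\<omega> \<in> space M. \<exists>s\<in>{0..t}. B s \<omega> \<in> T}"
    have eq: "survive t = space M - ?A"
      using that by (intro survive_eq_not_hit assms pos) auto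
    \<comment> \<open>The hitting event inherits measurability from its complement, as
      \<open>prob_compl\<close> requires.\<close>
    then have "space M - survive t = ?A" by auto
    then have "?A \<in> sets M" using sets_survive[OF that] by (metis sets.compl_sets)
    then show ?thesis unfolding p_def eq hitting_prob_def by (simp add: prob_compl)
  qed
  have upper: "\<forall>\<^sub>F t in at_top. p t \<le> U t"
  proof -
    have "\<forall>\<^sub>F t in at_top. sqrt t / ln t \<ge> R\<^sub>0" "\<forall>\<^sub>F t in at_top. ln t / 2 - ln (ln t) > C" "\<forall>\<^sub>F t::real in at_top. ln t > 1"
      by real_asymp+
    moreover have "\<forall>\<^sub>F t::real in at_top. t > 1" by (rule eventually_gt_at_top)
    ultimately show ?thesis
    proof eventually_elim
      case (elim t)
      have ln: "ln (sqrt t / ln t) = ln t / 2 - ln (ln t)"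
        using elim by (simp add: ln_div ln_sqrt)
      have "p t \<le> (sqrt t / ln t)\<^sup>2 / (2 * t) + pi * H z / (ln (sqrt t / ln t) - C)"
        unfolding p_def by (rule survival_prob_upper) (use elim ln in auto)
      also have "(sqrt t / ln t)\<^sup>2 / (2 * t) = 1 / (2 * (ln t)\<^sup>2)"
        using elim by (simp add: power_divide field_simps)
      finally show ?case by (simp add: U_def ln h_def)
    qed
  qed
  have lower: "\<forall>\<^sub>F t in at_top. L t \<le> p t"
  proof -
    have "\<forall>\<^sub>F t::real in at_top. ln t > 1" by real_asymp
    moreover have "\<forall>\<^sub>F t::real in at_top. t > 1" by (rule eventually_gt_at_top)
    ultimately show ?thesis
    proof eventually_elim
      case (elim t)
      have R: "sqrt (t * ln t) \<ge> 1"
        using mult_mono[of 1 t 1 "ln t"] elim by simp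
      have ln: "ln (sqrt (t * ln t)) = (ln t + ln (ln t)) / 2"
        using elim by (simp add: ln_sqrt ln_mult)
      have "h \<le> (C + (ln t + ln (ln t)) / 2) * p t + (2 * (norm z)\<^sup>2 + 16 * t) / (t * ln t)"
        using survival_prob_lower[OF _ R] elim by (simp add: h_def p_def ln)
      moreover have "ln (ln t) > 0" using elim by (intro ln_gt_zero)
      then have "C + (ln t + ln (ln t)) / 2 > 0"
        using elim(1) C_nonneg by (intro add_nonneg_pos divide_pos_pos add_pos_pos) simp_all
      ultimately show ?case by (simp add: L_def divide_le_eq mult.commute)
    qed
  qed
  \<comment> \<open>The excess over \<open>2 * h\<close> of the larger normalised error, cut at 0.
    The two errors tend to \<open>2 * h\<close> and \<open>h\<close>, so the excess tends to
    0.\<close>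
  define \<epsilon> where "\<epsilon> t = max 0 (max ((U t - 2 * h / (ln t - k)) / g t) ((2 * h / (ln t - k) - L t) / g t) - 2 * h)" for t
  have "(\<epsilon> \<longlongrightarrow> max 0 (max (2 * h) h - 2 * h)) at_top"
    unfolding \<epsilon>_def U_def L_def g_def
    by (intro tendsto_intros upper_error_asymptotics lower_error_asymptotics h)
  then have \<epsilon>: "(\<epsilon> \<longlongrightarrow> 0) at_top" using h by (simp add: max_def)
  have g: "\<forall>\<^sub>F t in at_top. g t > 0" unfolding g_def by real_asymp
  have "\<forall>\<^sub>F t in at_top.
       \<bar>hitting_prob M B T t - (1 - 2 * pi * H z / ln (t / \<tau>\<^sub>0))\<bar>
       \<le> ln ((ln (t / \<tau>\<^sub>0))\<^sup>2) / (ln (t / \<tau>\<^sub>0))\<^sup>2 * (2 * pi * H z + \<epsilon> t)"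
    using upper lower g eventually_gt_at_top[of 0]
  proof eventually_elim
    case (elim t)
    have ln: "ln (t / \<tau>\<^sub>0) = ln t - k" using elim \<tau> by (simp add: k_def ln_div)
    have scale: "x \<le> g t * (2 * h + \<epsilon> t)" if "x / g t - 2 * h \<le> \<epsilon> t" for x
    proof -
      have "x / g t \<le> 2 * h + \<epsilon> t" using that by simp
      then show ?thesis using elim(3) by (simp only: pos_divide_le_eq mult.commute)
    qed
    have "U t - 2 * h / (ln t - k) \<le> g t * (2 * h + \<epsilon> t)" "2 * h / (ln t - k) - L t \<le> g t * (2 * h + \<epsilon> t)"
      by (rule scale; simp only: \<epsilon>_def; simp add: max_def)+
    then have "\<bar>2 * h / (ln t - k) - p t\<bar> \<le> g t * (2 * h + \<epsilon> t)"
      using elim by linarith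
    then show ?case using hit[of t] elim by (simp add: ln g_def h_def mult.assoc)
  qed
  then show ?thesis using \<epsilon> unfolding H_def by blast
qed

end
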